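(* Let $\lambda_R=\lambda_R(d)$ be the reconstruction threshold for the hardcore measure $\mathbb{P}_{T_d}$ on the infinite $d$-regular tree $T_d$. Then, for large enough $d$, $$\frac{(\ln 2-o(1))\ln^2 d}{2\ln\ln d}\le\lambda_R\le(e+o(1))\ln^2 d,$$ where the $o(1)$ terms tend to $0$ as $d\to\infty$.
   Context: For $\lambda>0$, the density $\alpha=\alpha(\lambda,d)\in(0,1/2)$ is the unique solution of $\lambda=\frac{\alpha}{1-2\alpha}\left(\frac{1-\alpha}{1-2\alpha}\right)^{d-1}$. $\mathbb{P}_{T_d}$ (the translation invariant hardcore measure with fugacity $\lambda$) is the following measure on $\{0,1\}^{V(T_d)}$: the root $\rho$ has spin $1$ with probability $\alpha$ and spin $0$ with probability $1-\alpha$; then each other vertex's spin is generated from its parent's spin by one step of the Markov chain with $p_{11}=0$, $p_{10}=1$, $p_{01}=\frac{\alpha}{1-\alpha}$, $p_{00}=\frac{1-2\alpha}{1-\alpha}$ (where $p_{ij}$ is the probability of a child having spin $j$ given the parent has spin $i$). Let $\sigma(L)$ be the spins at distance $L$ from the root. The model has non-reconstruction if $\mathbb{P}_{T_d}(\sigma_\rho=1\mid\sigma(L))\to\alpha(\lambda,d)$ in probability as $L\to\infty$, and reconstruction otherwise. It is known that there is a critical fugacity $\lambda_R$ such that reconstruction holds for $\lambda>\lambda_R$ and non-reconstruction holds for $\lambda<\lambda_R$; this $\lambda_R$ is the reconstruction threshold. *)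

theory Defs
  imports "HOL-Probability.Probability"
begin

definition density_eq :: "nat \<Rightarrow> real \<Rightarrow> real \<Rightarrow> bool" where
  "density_eq d lam a \<longleftrightarrow> 0 < a \<and> a < 1/2 \<and>
     lam = a / (1 - 2*a) * ((1 - a) / (1 - 2*a)) ^ (d - 1)"

definition hc_density :: "nat \<Rightarrow> real \<Rightarrow> real" where
  "hc_density d lam = (THE a. density_eq d lam a)"

lemma hc_density_ex1:
  assumes "0 < lam"
  shows "\<exists>!a. density_eq d lam a"
proof -
  define f where "f = (\<lambda>a::real. a / (1 - 2*a) * ((1 - a) / (1 - 2*a)) ^ (d - 1))"
  have mono: "f a < f b" if "0 < a" "a < b" "b < 1/2" for a b
  proof -
    have 1: "a / (1 - 2*a) < b / (1 - 2*b)"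
      using that by (simp add: divide_simps) (simp add: algebra_simps)
    have 2: "(1 - a) / (1 - 2*a) \<le> (1 - b) / (1 - 2*b)"
      using that by (simp add: divide_simps) (simp add: algebra_simps)
    have 3: "0 < (1 - a) / (1 - 2*a)" using that by simp
    have 4: "((1 - a) / (1 - 2*a)) ^ (d-1) \<le> ((1 - b) / (1 - 2*b)) ^ (d-1)"
      using 2 3 by (intro power_mono) auto
    have 5: "0 \<le> a / (1 - 2*a)" using that by simp
    show ?thesis unfolding f_def
      by (rule mult_less_le_imp_less[OF 1 4 5 zero_less_power[OF 3]])
  qed
  define b where "b = lam / (1 + 2*lam)"
  have b: "0 < b" "b < 1/2" using assms by (auto simp: b_def divide_simps)
  have bb: "b / (1 - 2*b) = lam" using assms by (simp add: b_def divide_simps)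
  have "1 \<le> ((1 - b) / (1 - 2*b)) ^ (d-1)"
    using b by (intro one_le_power) (simp add: divide_simps)
  then have fb: "lam \<le> f b" unfolding f_def bb using assms by simp
  have cont: "continuous_on {0..b} f"
    unfolding f_def using b by (intro continuous_intros) auto
  obtain a where a: "0 \<le> a" "a \<le> b" "f a = lam"
    using IVT'[of f 0 lam b] fb assms b cont by (auto simp: f_def)
  have "a \<noteq> 0" using a assms by (auto simp: f_def)
  then have ex: "density_eq d lam a" using a b by (auto simp: density_eq_def f_def)
  show ?thesis
  proof (rule ex1I[of _ a])
    fix c assume c: "density_eq d lam c"
    then have "f c = f a" using a by (simp add: density_eq_def f_def)
    moreover have "0 < a" "a < 1/2" "0 < c" "c < 1/2"
      using c ex by (simp_all only: density_eq_def)
    ultimately show "c = a"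
      using mono[of a c] mono[of c a] by linarith
  qed (fact ex)
qed

lemma hc_density_eq: "0 < lam \<Longrightarrow> density_eq d lam (hc_density d lam)"
  unfolding hc_density_def by (rule theI'[OF hc_density_ex1])

text \<open>The infinite \<open>d\<close>-regular tree: a vertex is coded by the path leading to it, most recent step
  first, so the root is \<open>[]\<close>, the parent of \<open>i # v\<close> is \<open>v\<close>, and the distance of \<open>v\<close> from the root is
  \<open>length v\<close>. The root has \<open>d\<close> children and every other vertex has \<open>d - 1\<close>, so all degrees
  are \<open>d\<close> (for \<open>d \<ge> 1\<close>).\<close>

primrec is_vertex :: "nat \<Rightarrow> nat list \<Rightarrow> bool" where
  "is_vertex d [] \<longleftrightarrow> True"
| "is_vertex d (i # v) \<longleftrightarrow> is_vertex d v \<and> i < (if v = [] then d else d - 1)"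

definition tree_vertices :: "nat \<Rightarrow> nat list set" where
  "tree_vertices d = {v. is_vertex d v}"

definition tree_level :: "nat \<Rightarrow> nat \<Rightarrow> nat list set" where
  "tree_level d L = {v \<in> tree_vertices d. length v = L}"

text \<open>Spin 1 is \<open>True\<close>, spin 0 is \<open>False\<close>. The law of a vertex's spin, given the spin of its parent
  (\<open>None\<close> for the root).\<close>

fun spin_law :: "real \<Rightarrow> bool option \<Rightarrow> bool pmf" where
  "spin_law a None = bernoulli_pmf a"
| "spin_law a (Some True) = return_pmf False"
| "spin_law a (Some False) = bernoulli_pmf (a / (1 - a))"

text \<open>All randomness is drawn in advance: for every vertex \<open>v\<close> and every possible parent spin \<open>s\<close> there
  is an independent draw \<open>\<omega> (v, s)\<close> with law \<open>spin_law a s\<close>, and each vertex uses the draw indexed by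
  the actual spin of its parent.\<close>

primrec tree_spin :: "(nat list \<times> bool option \<Rightarrow> bool) \<Rightarrow> nat list \<Rightarrow> bool" where
  "tree_spin \<omega> [] = \<omega> ([], None)"
| "tree_spin \<omega> (i # v) = \<omega> (i # v, Some (tree_spin \<omega> v))"

definition config_space :: "nat list set \<Rightarrow> (nat list \<Rightarrow> bool) measure" where
  "config_space W = PiM W (\<lambda>_. count_space UNIV)"

definition draws :: "nat \<Rightarrow> real \<Rightarrow> (nat list \<times> bool option \<Rightarrow> bool) measure" where
  "draws d a = PiM (tree_vertices d \<times> UNIV) (\<lambda>j. measure_pmf (spin_law a (snd j)))"

definition tree_chain :: "nat \<Rightarrow> real \<Rightarrow> (nat list \<Rightarrow> bool) measure" where
  "tree_chain d a = distr (draws d a) (config_space (tree_vertices d))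
     (\<lambda>\<omega>. restrict (tree_spin \<omega>) (tree_vertices d))"

definition hardcore_measure :: "nat \<Rightarrow> real \<Rightarrow> (nat list \<Rightarrow> bool) measure" where
  "hardcore_measure d lam = tree_chain d (hc_density d lam)"

lemma measurable_tree_spin:
  assumes "v \<in> tree_vertices d"
  shows "(\<lambda>\<omega>. tree_spin \<omega> v) \<in> draws d a \<rightarrow>\<^sub>M count_space UNIV"
proof -
  have coord: "(\<lambda>\<omega>. \<omega> (u, s)) \<in> draws d a \<rightarrow>\<^sub>M count_space UNIV" if "u \<in> tree_vertices d" for u s
  proof -
    have "(\<lambda>\<omega>. \<omega> (u, s)) \<in> draws d a \<rightarrow>\<^sub>M (\<lambda>j. measure_pmf (spin_law a (snd j))) (u, s)"
      unfolding draws_def using that by (intro measurable_component_singleton) auto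
    also have "\<dots> = draws d a \<rightarrow>\<^sub>M count_space UNIV"
      by (intro measurable_cong_sets) auto
    finally show ?thesis .
  qed
  from assms show ?thesis
  proof (induction v)
    case Nil
    then show ?case using coord by simp
  next
    case (Cons i v)
    then have v: "v \<in> tree_vertices d" by (simp add: tree_vertices_def)
    have "(\<lambda>\<omega>. if tree_spin \<omega> v then \<omega> (i # v, Some True) else \<omega> (i # v, Some False))
        \<in> draws d a \<rightarrow>\<^sub>M count_space UNIV"
      using coord[OF Cons.prems] Cons.IH[OF v] by measurable
    moreover have "(\<lambda>\<omega>. if tree_spin \<omega> v then \<omega> (i # v, Some True) else \<omega> (i # v, Some False))
        = (\<lambda>\<omega>. tree_spin \<omega> (i # v))"
      by (intro ext) (simp split: if_split)
    ultimately show ?case by (simp only:)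
  qed
qed

lemma measurable_tree_config:
  "(\<lambda>\<omega>. restrict (tree_spin \<omega>) (tree_vertices d)) \<in> draws d a \<rightarrow>\<^sub>M config_space (tree_vertices d)"
  unfolding config_space_def
  by (intro measurable_restrict measurable_tree_spin)

lemma prob_space_draws: "prob_space (draws d a)"
  unfolding draws_def
  by (intro prob_space_PiM measure_pmf.prob_space_axioms)

lemma prob_space_tree_chain: "prob_space (tree_chain d a)"
  unfolding tree_chain_def
  by (intro prob_space.prob_space_distr[OF prob_space_draws] measurable_tree_config)

lemma prob_space_hardcore_measure: "prob_space (hardcore_measure d lam)"
  unfolding hardcore_measure_def by (rule prob_space_tree_chain)

lemma sets_tree_chain: "sets (tree_chain d a) = sets (config_space (tree_vertices d))"
  by (simp add: tree_chain_def)

lemma space_tree_chain: "space (tree_chain d a) = space (config_space (tree_vertices d))"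
  by (simp add: tree_chain_def)

definition parent_spin :: "(nat list \<Rightarrow> bool) \<Rightarrow> nat list \<Rightarrow> bool option" where
  "parent_spin \<sigma> v = (case v of [] \<Rightarrow> None | i # u \<Rightarrow> Some (\<sigma> u))"

theorem tree_chain_cylinder:
  assumes W: "finite W" "W \<subseteq> tree_vertices d" and closed: "\<And>i v. i # v \<in> W \<Longrightarrow> v \<in> W"
  shows "measure (tree_chain d a) {\<sigma> \<in> space (tree_chain d a). \<forall>v\<in>W. \<sigma> v = s v}
           = (\<Prod>v\<in>W. pmf (spin_law a (parent_spin s v)) (s v))"
proof -
  interpret product_prob_space "\<lambda>j. measure_pmf (spin_law a (snd j))" "tree_vertices d \<times> UNIV"
    by (rule product_prob_spaceI) (rule measure_pmf.prob_space_axioms)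
  define J where "J = (\<lambda>v. (v, parent_spin s v)) ` W"
  define A where "A = {\<sigma> \<in> space (tree_chain d a). \<forall>v\<in>W. \<sigma> v = s v}"
  have spin_iff: "(\<forall>v\<in>W. tree_spin \<omega> v = s v) \<longleftrightarrow> (\<forall>v\<in>W. \<omega> (v, parent_spin s v) = s v)"
    (is "?L \<longleftrightarrow> ?R") for \<omega>
  proof
    assume L: ?L
    show ?R
    proof
      fix v assume v: "v \<in> W"
      show "\<omega> (v, parent_spin s v) = s v"
      proof (cases v)
        case Nil
        then show ?thesis using L v by (metis list.case(1) parent_spin_def tree_spin.simps(1))
      next
        case (Cons i u)
        then have "tree_spin \<omega> u = s u" using L v closed by blast
        moreover have "tree_spin \<omega> (i # u) = s v" using L v Cons by blast
        ultimately show ?thesis using Cons by (simp add: parent_spin_def)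
      qed
    qed
  next
    assume R: ?R
    have "v \<in> W \<Longrightarrow> tree_spin \<omega> v = s v" for v
    proof (induction v)
      case Nil
      then have "\<omega> ([], parent_spin s []) = s []" using R by blast
      then show ?case by (simp add: parent_spin_def)
    next
      case (Cons i u)
      have "tree_spin \<omega> u = s u" using Cons.IH closed[OF Cons.prems] by blast
      moreover have "\<omega> (i # u, parent_spin s (i # u)) = s (i # u)" using R Cons.prems by blast
      ultimately show ?case by (simp add: parent_spin_def)
    qed
    then show ?L by blast
  qed
  have "A \<in> sets (tree_chain d a)"
  proof -
    have "(\<lambda>\<sigma>. \<sigma> v) \<in> tree_chain d a \<rightarrow>\<^sub>M count_space UNIV" if "v \<in> W" for v
      using that W unfolding measurable_cong_sets[OF sets_tree_chain refl] config_space_def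
      by (intro measurable_component_singleton) auto
    from measurable_sets[OF this, of _ "{s _}"]
    have "{\<sigma> \<in> space (tree_chain d a). \<sigma> v = s v} \<in> sets (tree_chain d a)" if "v \<in> W" for v
      using that by (simp add: vimage_def Int_def conj_commute)
    then show ?thesis unfolding A_def using W(1)
      by (rule sets.sets_Collect_finite_All)
  qed
  then have "A \<in> sets (config_space (tree_vertices d))" by (simp add: sets_tree_chain)
  then have "measure (tree_chain d a) A = measure (draws d a)
      ((\<lambda>\<omega>. restrict (tree_spin \<omega>) (tree_vertices d)) -` A \<inter> space (draws d a))"
    unfolding tree_chain_def
    by (rule measure_distr[OF measurable_tree_config])
  also have "(\<lambda>\<omega>. restrict (tree_spin \<omega>) (tree_vertices d)) -` A \<inter> space (draws d a)
      = {\<omega> \<in> space (draws d a). \<forall>v\<in>W. tree_spin \<omega> v = s v}"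
  proof (rule set_eqI)
    fix \<omega>
    have "restrict (tree_spin \<omega>) (tree_vertices d) \<in> space (tree_chain d a)"
      if "\<omega> \<in> space (draws d a)"
      unfolding space_tree_chain by (rule measurable_space[OF measurable_tree_config that])
    moreover have "(\<forall>v\<in>W. restrict (tree_spin \<omega>) (tree_vertices d) v = s v)
        \<longleftrightarrow> (\<forall>v\<in>W. tree_spin \<omega> v = s v)"
      using W(2) by (intro ball_cong refl) (simp add: subset_eq)
    ultimately show "\<omega> \<in> (\<lambda>\<omega>. restrict (tree_spin \<omega>) (tree_vertices d)) -` A \<inter> space (draws d a)
        \<longleftrightarrow> \<omega> \<in> {\<omega> \<in> space (draws d a). \<forall>v\<in>W. tree_spin \<omega> v = s v}"
      unfolding A_def by blast
  qed
  also have "\<dots> = {\<omega> \<in> space (draws d a). \<forall>j\<in>J. \<omega> j \<in> {s (fst j)}}"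
    by (auto simp: spin_iff J_def)
  also have "measure (draws d a) \<dots> = (\<Prod>j\<in>J. pmf (spin_law a (snd j)) (s (fst j)))"
  proof -
    have "emeasure (draws d a) {\<omega> \<in> space (draws d a). \<forall>j\<in>J. \<omega> j \<in> {s (fst j)}}
        = (\<Prod>j\<in>J. emeasure ((\<lambda>j. measure_pmf (spin_law a (snd j))) j) {s (fst j)})"
      unfolding draws_def using W by (intro emeasure_PiM_Collect) (auto simp: J_def)
    also have "\<dots> = (\<Prod>j\<in>J. ennreal (pmf (spin_law a (snd j)) (s (fst j))))"
      by (intro prod.cong) (auto simp: emeasure_pmf_single)
    finally show ?thesis
      by (simp add: measure_def prod_ennreal prod_nonneg)
  qed
  also have "\<dots> = (\<Prod>v\<in>W. pmf (spin_law a (parent_spin s v)) (s v))"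
    unfolding J_def by (subst prod.reindex) (auto simp: inj_on_def)
  finally show ?thesis unfolding A_def .
qed

definition level_algebra :: "nat \<Rightarrow> nat \<Rightarrow> (nat list \<Rightarrow> bool) measure" where
  "level_algebra d L = vimage_algebra (space (config_space (tree_vertices d)))
     (\<lambda>\<sigma>. restrict \<sigma> (tree_level d L)) (config_space (tree_level d L))"

lemma subalgebra_level_algebra: "subalgebra (hardcore_measure d lam) (level_algebra d L)"
proof -
  have "(\<lambda>\<sigma>. restrict \<sigma> (tree_level d L)) \<in> hardcore_measure d lam \<rightarrow>\<^sub>M config_space (tree_level d L)"
    unfolding hardcore_measure_def measurable_cong_sets[OF sets_tree_chain refl] config_space_def
    by (intro measurable_restrict_subset) (auto simp: tree_level_def)
  then show ?thesis
    by (simp add: subalgebra_def level_algebra_def measurable_iff_sets hardcore_measure_def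
        space_tree_chain)
qed

definition root_occupied_prob :: "nat \<Rightarrow> real \<Rightarrow> nat \<Rightarrow> (nat list \<Rightarrow> bool) \<Rightarrow> real" where
  "root_occupied_prob d lam L = real_cond_exp (hardcore_measure d lam) (level_algebra d L)
     (indicat_real {\<sigma> \<in> space (hardcore_measure d lam). \<sigma> []})"

definition tendsto_in_probability ::
    "'a measure \<Rightarrow> (nat \<Rightarrow> 'a \<Rightarrow> real) \<Rightarrow> real \<Rightarrow> bool" where
  "tendsto_in_probability M X c \<longleftrightarrow>
     (\<forall>\<epsilon>>0. (\<lambda>n. measure M {x \<in> space M. \<bar>X n x - c\<bar> > \<epsilon>}) \<longlonglongrightarrow> 0)"

definition nonreconstruction :: "nat \<Rightarrow> real \<Rightarrow> bool" where
  "nonreconstruction d lam \<longleftrightarrow>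
     tendsto_in_probability (hardcore_measure d lam) (root_occupied_prob d lam) (hc_density d lam)"

definition reconstruction :: "nat \<Rightarrow> real \<Rightarrow> bool" where
  "reconstruction d lam \<longleftrightarrow> \<not> nonreconstruction d lam"

definition is_reconstruction_threshold :: "nat \<Rightarrow> real \<Rightarrow> bool" where
  "is_reconstruction_threshold d r \<longleftrightarrow> 0 < r \<and>
     (\<forall>lam>r. reconstruction d lam) \<and>
     (\<forall>lam. 0 < lam \<and> lam < r \<longrightarrow> nonreconstruction d lam)"

lemma reconstruction_threshold_unique:
  assumes "is_reconstruction_threshold d r" "is_reconstruction_threshold d r'"
  shows "r = r'"
proof -
  have False if "is_reconstruction_threshold d x" "is_reconstruction_threshold d y" "x < y" for x y
  proof -
    obtain z where "x < z" "z < y" using dense[OF \<open>x < y\<close>] by blast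
    then show False using that by (auto simp: is_reconstruction_threshold_def reconstruction_def)
  qed
  then show ?thesis using assms by (metis linorder_neqE_linordered_idom)
qed

end

theory Submission
  imports Defs "HOL-Real_Asymp.Real_Asymp"
begin

text \<open>
Let \<open>p\<close> be the probability that a child of a vacant vertex is occupied. The density equation
  becomes \<open>lam = p / (1 - p) ^ d\<close>, so that \<open>d * p\<close> is close to \<open>ln d\<close> for the fugacities in question.
  Let \<open>P\<^sub>1\<close> and \<open>P\<^sub>0\<close> be the laws of the spins at depth \<open>n\<close> below a vertex that is occupied or vacant.
  Children of an occupied vertex are vacant, so \<open>P\<^sub>1\<close> is the product of the laws \<open>P\<^sub>0\<close> of the
  children, while \<open>P\<^sub>0\<close> is the product of the mixtures \<open>p P\<^sub>1 + (1 - p) P\<^sub>0\<close>. Hence sums of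
  multiplicative functions of \<open>(P\<^sub>1, P\<^sub>0)\<close> over all configurations factor over the children
  (\<open>sum_children\<close>). Integrating the conditional probability of an occupied root over an event \<open>A\<close> of
  level \<open>L\<close> gives a multiple of \<open>P\<^sub>1 A - P\<^sub>0 A\<close> after centring; therefore reconstruction
  fails if the total variation distance tends to 0 and holds if some events keep this difference
  away from 0 (\<open>nonreconstruction_if_total_variation\<close>, \<open>reconstruction_if_test\<close>).

  Upper bound. Declare a vertex occupied when all of its children are declared vacant, starting from
  the true spins of level \<open>L\<close>. If the error probabilities of the children are at most
  \<open>1 / (d * ln d)\<close> (false alarm) and \<open>1 / ln d\<close> (miss), then the parent's false alarm probability is
  at most about \<open>(1 - p) ^ (d - 1) * e\<close>, that is \<open>e * ln d / (d * lam)\<close>, and the parent's miss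
  probability is at most \<open>1 / ln d\<close>. The two bounds reproduce themselves as soon as \<open>lam\<close> exceeds
  \<open>e * (ln d)\<^sup>2\<close> by a constant factor (\<open>reconstruction_criterion\<close>).

  Lower bound. Let \<open>R = P\<^sub>1 / P\<^sub>0\<close>. At depth 1, a vertex without occupied child has
  posterior odds \<open>p * R / (1 - p) = lam\<close> of being occupied, given a vacant parent. A vertex at depth 2
  with such a child has itself odds of at most 1, and just below 1 if there is exactly one such child.
  An occupied vertex at depth 3 has on average about \<open>(ln d)\<^sup>2 / lam\<close> children of the latter kind, and
  each of them divides its odds, which would be \<open>lam\<close> without them, by about 2. Since
  \<open>lam\<close> is less than \<open>(ln d)\<^sup>2\<close>, the odds at depth 3 become small when
  \<open>ln 2 * (ln d)\<^sup>2 / lam\<close> exceeds \<open>2 * ln (ln d)\<close>, and this is where the constant of the theorem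
  comes from; a small fractional moment of the odds makes this rigorous (\<open>lik_sum_depth_two_vac_powr\<close>,
  \<open>lik_sum_odds_Suc\<close>). An occupied vertex then goes unnoticed with probability at least one half, which
  reduces the second moment of \<open>R\<close> at depth 4 to about its square root (\<open>second_moment_depth_four\<close>). This
  is in the domain where the recursion for the variance of \<open>R\<close> is a contraction
  (\<open>second_moment_step\<close>, \<open>sum_abs_lik_tendsto_0\<close>), so the total variation distance tends to 0.

  Because reconstruction holds above the threshold and fails below it, one fugacity on
  each side suffices to enclose the threshold.
\<close>

section \<open>Likelihoods of boundary configurations\<close>

definition num_children :: "nat \<Rightarrow> nat list \<Rightarrow> nat" where
  "num_children d v = (if v = [] then d else d - 1)"

text \<open>The vertices at distance \<open>n\<close> below \<open>v\<close>; by recursion from the top, which is the direction in which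
  likelihoods factor.\<close>

primrec descendants :: "nat \<Rightarrow> nat \<Rightarrow> nat list \<Rightarrow> nat list set" where
  "descendants d 0 v = {v}"
| "descendants d (Suc n) v = (\<Union>i<num_children d v. descendants d n (i # v))"

abbreviation configs :: "nat list set \<Rightarrow> (nat list \<Rightarrow> bool) set" where
  "configs D \<equiv> PiE D (\<lambda>_. UNIV)"

text \<open>The probability that the spins of \<open>descendants d n v\<close> are those of \<open>t\<close>, given that \<open>v\<close> has spin
  \<open>b\<close>. The argument \<open>t\<close> is a spin assignment to all vertices, so that restrictions to the subtrees of
  the children never have to be written down.\<close>

primrec lik :: "nat \<Rightarrow> real \<Rightarrow> nat \<Rightarrow> nat list \<Rightarrow> bool \<Rightarrow> (nat list \<Rightarrow> bool) \<Rightarrow> real" where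
  "lik d p 0 v b t = of_bool (t v = b)"
| "lik d p (Suc n) v b t = (\<Prod>i<num_children d v.
     if b then lik d p n (i # v) False t
     else p * lik d p n (i # v) True t + (1 - p) * lik d p n (i # v) False t)"

text \<open>The same likelihood, given that the parent of \<open>v\<close> is vacant.\<close>

abbreviation mix :: "nat \<Rightarrow> real \<Rightarrow> nat \<Rightarrow> nat list \<Rightarrow> (nat list \<Rightarrow> bool) \<Rightarrow> real" where
  "mix d p n v t \<equiv> p * lik d p n v True t + (1 - p) * lik d p n v False t"

text \<open>Integrals of functions of the two likelihoods: with \<open>x\<close> and \<open>y\<close> the likelihoods given an occupied
  and a vacant vertex, the weight \<open>x\<close> or \<open>y\<close> in \<open>g x y\<close> selects the law with respect to which one integrates.\<close>

definition lik_sum :: "nat \<Rightarrow> real \<Rightarrow> nat \<Rightarrow> nat list \<Rightarrow> (real \<Rightarrow> real \<Rightarrow> real) \<Rightarrow> real" where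
  "lik_sum d p n v g = (\<Sum>t\<in>configs (descendants d n v). g (lik d p n v True t) (lik d p n v False t))"

lemma finite_descendants [simp]: "finite (descendants d n v)"
  by (induction n arbitrary: v) auto

lemma finite_configs [simp]: "finite D \<Longrightarrow> finite (configs D)"
  by (simp add: finite_PiE)

lemma descendants_suffix: "u \<in> descendants d n v \<Longrightarrow> \<exists>w. u = w @ v \<and> length w = n"
proof (induction n arbitrary: v)
  case (Suc n)
  then obtain i where "u \<in> descendants d n (i # v)" by auto
  from Suc.IH[OF this] obtain w where "u = w @ i # v" "length w = n" by blast
  then show ?case by (intro exI[of _ "w @ [i]"]) auto
qed auto

lemma disjoint_descendants:
  "i \<noteq> j \<Longrightarrow> descendants d n (i # v) \<inter> descendants d n (j # v) = {}"
  using descendants_suffix[of _ d n "i # v"] descendants_suffix[of _ d n "j # v"]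
  by (metis Int_emptyI append_eq_append_conv list.inject)

lemma lik_cong: "(\<And>u. u \<in> descendants d n v \<Longrightarrow> t u = t' u) \<Longrightarrow> lik d p n v b t = lik d p n v b t'"
proof (induction n arbitrary: v b)
  case (Suc n)
  have "lik d p n (i # v) c t = lik d p n (i # v) c t'" if "i < num_children d v" for i c
    using that Suc.prems by (intro Suc.IH) auto
  then show ?case by (auto intro!: prod.cong)
qed simp

lemma lik_nonneg: "0 \<le> p \<Longrightarrow> p \<le> 1 \<Longrightarrow> 0 \<le> lik d p n v b t"
  by (induction n arbitrary: v b) (auto intro!: prod_nonneg)

text \<open>Fubini for functions that each look at one of two disjoint sets of vertices: a configuration on the
  union is glued from its two restrictions.\<close>

lemma sum_configs_Un:
  fixes g h :: "(nat list \<Rightarrow> bool) \<Rightarrow> real"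
  assumes "A \<inter> B = {}"
    and g: "\<And>t t'. (\<And>u. u \<in> A \<Longrightarrow> t u = t' u) \<Longrightarrow> g t = g t'"
    and h: "\<And>t t'. (\<And>u. u \<in> B \<Longrightarrow> t u = t' u) \<Longrightarrow> h t = h t'"
  shows "(\<Sum>t\<in>configs (A \<union> B). g t * h t) = (\<Sum>t\<in>configs A. g t) * (\<Sum>t\<in>configs B. h t)"
proof -
  define glue :: "(nat list \<Rightarrow> bool) \<times> (nat list \<Rightarrow> bool) \<Rightarrow> nat list \<Rightarrow> bool"
    where "glue = (\<lambda>x u. if u \<in> A then fst x u else snd x u)"
  have bij: "bij_betw glue (configs A \<times> configs B) (configs (A \<union> B))"
  proof (rule bij_betw_byWitness[where f' = "\<lambda>t. (restrict t A, restrict t B)"])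
    show "\<forall>x\<in>configs A \<times> configs B. (restrict (glue x) A, restrict (glue x) B) = x"
    proof
      fix x assume "x \<in> configs A \<times> configs B"
      then have x: "fst x \<in> configs A" "snd x \<in> configs B"
        by (simp_all only: mem_Times_iff)
      have "restrict (glue x) A u = fst x u" for u
        by (cases "u \<in> A") (simp_all add: glue_def PiE_arb[OF x(1)])
      moreover have "restrict (glue x) B u = snd x u" for u
        using assms(1) by (cases "u \<in> B") (auto simp: glue_def PiE_arb[OF x(2)])
      ultimately show "(restrict (glue x) A, restrict (glue x) B) = x"
        by (simp add: prod_eq_iff fun_eq_iff)
    qed
    show "\<forall>t\<in>configs (A \<union> B). glue (restrict t A, restrict t B) = t"
    proof
      fix t assume t: "t \<in> configs (A \<union> B)"
      have "glue (restrict t A, restrict t B) u = t u" for u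
        by (cases "u \<in> A \<union> B") (auto simp: glue_def PiE_arb[OF t])
      then show "glue (restrict t A, restrict t B) = t" by (simp add: fun_eq_iff)
    qed
    show "glue ` (configs A \<times> configs B) \<subseteq> configs (A \<union> B)"
    proof (rule image_subsetI)
      fix x assume "x \<in> configs A \<times> configs B"
      then have x: "fst x \<in> configs A" "snd x \<in> configs B"
        by (simp_all only: mem_Times_iff)
      show "glue x \<in> configs (A \<union> B)"
        by (simp add: glue_def PiE_iff extensional_def PiE_arb[OF x(2)])
    qed
    show "(\<lambda>t. (restrict t A, restrict t B)) ` configs (A \<union> B) \<subseteq> configs A \<times> configs B"
      by (simp add: image_subset_iff)
  qed
  have gh: "g (glue x) * h (glue x) = g (fst x) * h (snd x)" for x
  proof -
    have "g (glue x) = g (fst x)" by (rule g) (simp add: glue_def)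
    moreover have "h (glue x) = h (snd x)" using assms(1) by (intro h) (auto simp: glue_def)
    ultimately show ?thesis by simp
  qed
  have "(\<Sum>t\<in>configs (A \<union> B). g t * h t)
      = (\<Sum>x\<in>configs A \<times> configs B. g (glue x) * h (glue x))"
    using sum.reindex_bij_betw[OF bij, of "\<lambda>t. g t * h t"] by simp
  also have "\<dots> = (\<Sum>x\<in>configs A \<times> configs B. g (fst x) * h (snd x))"
    by (simp only: gh)
  also have "\<dots> = (\<Sum>t\<in>configs A. g t) * (\<Sum>t\<in>configs B. h t)"
    by (simp add: sum_product sum.cartesian_product case_prod_beta)
  finally show ?thesis .
qed

lemma sum_configs_UN:
  fixes g :: "'i \<Rightarrow> (nat list \<Rightarrow> bool) \<Rightarrow> real"
  assumes "finite I" "disjoint_family_on D I"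
    and "\<And>i t t'. i \<in> I \<Longrightarrow> (\<And>u. u \<in> D i \<Longrightarrow> t u = t' u) \<Longrightarrow> g i t = g i t'"
  shows "(\<Sum>t\<in>configs (\<Union>i\<in>I. D i). \<Prod>i\<in>I. g i t) = (\<Prod>i\<in>I. \<Sum>t\<in>configs (D i). g i t)"
  using assms
proof (induction I)
  case (insert j I)
  have "(\<Sum>t\<in>configs (\<Union>i\<in>insert j I. D i). \<Prod>i\<in>insert j I. g i t)
      = (\<Sum>t\<in>configs (D j \<union> (\<Union>i\<in>I. D i)). g j t * (\<Prod>i\<in>I. g i t))"
    using insert.hyps by simp
  also have "\<dots> = (\<Sum>t\<in>configs (D j). g j t) * (\<Sum>t\<in>configs (\<Union>i\<in>I. D i). \<Prod>i\<in>I. g i t)"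
  proof (rule sum_configs_Un[where g = "g j" and h = "\<lambda>t. \<Prod>i\<in>I. g i t"])
    show "D j \<inter> (\<Union>i\<in>I. D i) = {}"
    proof -
      have "D j \<inter> D i = {}" if "i \<in> I" for i
        using disjoint_family_onD[OF insert.prems(1), of j i] insert.hyps that by auto
      then show ?thesis by blast
    qed
  next
    fix t t' :: "nat list \<Rightarrow> bool" assume "\<And>u. u \<in> D j \<Longrightarrow> t u = t' u"
    then show "g j t = g j t'" by (intro insert.prems(2)) auto
  next
    fix t t' :: "nat list \<Rightarrow> bool" assume *: "\<And>u. u \<in> (\<Union>i\<in>I. D i) \<Longrightarrow> t u = t' u"
    show "(\<Prod>i\<in>I. g i t) = (\<Prod>i\<in>I. g i t')"
    proof (rule prod.cong[OF refl])
      fix i assume "i \<in> I"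
      then show "g i t = g i t'" using * by (intro insert.prems(2)) auto
    qed
  qed
  also have "(\<Sum>t\<in>configs (\<Union>i\<in>I. D i). \<Prod>i\<in>I. g i t) = (\<Prod>i\<in>I. \<Sum>t\<in>configs (D i). g i t)"
  proof (rule insert.IH)
    show "disjoint_family_on D I" using insert.prems(1) by (auto simp: disjoint_family_on_def)
    show "g i t = g i t'" if "i \<in> I" "\<And>u. u \<in> D i \<Longrightarrow> t u = t' u" for i t t'
      using that by (intro insert.prems(2)) auto
  qed
  finally show ?case using insert.hyps by simp
qed simp

text \<open>Given the spins of the children of \<open>v\<close>, their subtrees are independent; this is the form in which
  that independence is used.\<close>

lemma sum_children:
  assumes "\<And>i t t'. i < num_children d v \<Longrightarrow>
      (\<And>u. u \<in> descendants d n (i # v) \<Longrightarrow> t u = t' u) \<Longrightarrow> g i t = g i t'"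
  shows "(\<Sum>t\<in>configs (descendants d (Suc n) v). \<Prod>i<num_children d v. g i t :: real)
    = (\<Prod>i<num_children d v. \<Sum>t\<in>configs (descendants d n (i # v)). g i t)"
  unfolding descendants.simps
proof (rule sum_configs_UN)
  show "disjoint_family_on (\<lambda>i. descendants d n (i # v)) {..<num_children d v}"
    by (auto simp: disjoint_family_on_def disjoint_descendants)
  show "g i t = g i t'" if "i \<in> {..<num_children d v}"
    "\<And>u. u \<in> descendants d n (i # v) \<Longrightarrow> t u = t' u" for i t t'
    using that by (intro assms) auto
qed simp

lemma sum_children_lik:
  "(\<Sum>t\<in>configs (descendants d (Suc n) v). \<Prod>i<num_children d v.
      g (lik d p n (i # v) True t) (lik d p n (i # v) False t) :: real)
    = (\<Prod>i<num_children d v. lik_sum d p n (i # v) g)"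
  unfolding lik_sum_def
proof (rule sum_children)
  fix i and t t' :: "nat list \<Rightarrow> bool" assume *: "\<And>u. u \<in> descendants d n (i # v) \<Longrightarrow> t u = t' u"
  have "lik d p n (i # v) b t = lik d p n (i # v) b t'" for b
    by (rule lik_cong) (rule *)
  then show "g (lik d p n (i # v) True t) (lik d p n (i # v) False t)
      = g (lik d p n (i # v) True t') (lik d p n (i # v) False t')" by simp
qed

lemma lik_sum_0: "lik_sum d p 0 v g = g 1 0 + g 0 1"
proof -
  have 1: "configs {v} = (\<lambda>c. (\<lambda>_. undefined)(v := c)) ` UNIV"
    unfolding PiE_insert_eq[of v "{}"] PiE_empty_domain by force
  have 2: "inj (\<lambda>c::bool. (\<lambda>_. undefined)(v := c))"
    by (rule injI) (metis fun_upd_same)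
  show ?thesis
    unfolding lik_sum_def descendants.simps 1 sum.reindex[OF 2] by (simp add: UNIV_bool)
qed

lemma lik_sum_add: "lik_sum d p n v (\<lambda>x y. g x y + h x y) = lik_sum d p n v g + lik_sum d p n v h"
  by (simp add: lik_sum_def sum.distrib)

lemma lik_sum_diff: "lik_sum d p n v (\<lambda>x y. g x y - h x y) = lik_sum d p n v g - lik_sum d p n v h"
  by (simp add: lik_sum_def sum_subtractf)

lemma lik_sum_cmult: "lik_sum d p n v (\<lambda>x y. c * g x y) = c * lik_sum d p n v g"
  by (simp add: lik_sum_def sum_distrib_left)

lemma lik_sum_lik:
  "lik_sum d p n v (\<lambda>x y. x) = 1 \<and> lik_sum d p n v (\<lambda>x y. y) = 1"
proof (induction n arbitrary: v)
  case 0
  then show ?case by (simp add: lik_sum_0)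
next
  case (Suc n)
  have "lik_sum d p (Suc n) v (\<lambda>x y. x) = (\<Prod>i<num_children d v. lik_sum d p n (i # v) (\<lambda>x y. y))"
    by (subst sum_children_lik[symmetric]) (simp add: lik_sum_def)
  moreover have "lik_sum d p (Suc n) v (\<lambda>x y. y)
      = (\<Prod>i<num_children d v. lik_sum d p n (i # v) (\<lambda>x y. p * x + (1 - p) * y))"
    by (subst sum_children_lik[symmetric]) (simp add: lik_sum_def)
  ultimately show ?case using Suc.IH by (simp add: lik_sum_add lik_sum_cmult)
qed

lemmas lik_sum_True = conjunct1[OF lik_sum_lik] and lik_sum_False = conjunct2[OF lik_sum_lik]

section \<open>The law of a level\<close>

lemma is_vertex_append: "is_vertex d (w @ v) \<Longrightarrow> is_vertex d v"
  by (induction w) auto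

text \<open>The recursive description of a level agrees with the one by word length, where a descendant extends
  the code of \<open>v\<close> on the left.\<close>

lemma descendants_eq:
  "is_vertex d v \<Longrightarrow> descendants d n v = {u. is_vertex d u \<and> (\<exists>w. u = w @ v \<and> length w = n)}"
proof (induction n arbitrary: v)
  case (Suc n)
  have IH: "descendants d n (i # v) = {u. is_vertex d u \<and> (\<exists>w. u = w @ i # v \<and> length w = n)}"
    if "i < num_children d v" for i
    using that Suc.prems by (intro Suc.IH) (simp add: num_children_def)
  show ?case
  proof (intro equalityI subsetI)
    fix u assume "u \<in> descendants d (Suc n) v"
    then obtain i w where "is_vertex d u" "u = w @ i # v" "length w = n" using IH by auto
    then show "u \<in> {u. is_vertex d u \<and> (\<exists>w. u = w @ v \<and> length w = Suc n)}"
      by (auto intro!: exI[of _ "w @ [i]"])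
  next
    fix u assume "u \<in> {u. is_vertex d u \<and> (\<exists>w. u = w @ v \<and> length w = Suc n)}"
    then obtain w where u: "is_vertex d u" "u = w @ v" "length w = Suc n" by blast
    then obtain w' i where w: "w = w' @ [i]" by (metis length_Suc_conv_rev)
    have "is_vertex d (i # v)" using u w is_vertex_append[of d w' "i # v"] by simp
    then have "i < num_children d v" by (simp add: num_children_def)
    then show "u \<in> descendants d (Suc n) v" using IH u w by auto
  qed
qed auto

lemma tree_level_eq: "tree_level d L = descendants d L []"
  by (auto simp: tree_level_def tree_vertices_def descendants_eq)

lemma finite_tree_level [simp]: "finite (tree_level d L)"
  by (simp add: tree_level_eq)

lemma prod_tree_level_Suc:
  fixes h :: "nat list \<Rightarrow> real"
  shows "(\<Prod>u\<in>tree_level d (Suc m). h u) = (\<Prod>v\<in>tree_level d m. \<Prod>i<num_children d v. h (i # v))"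
proof -
  have "tree_level d (Suc m) = (\<Union>v\<in>tree_level d m. (\<lambda>i. i # v) ` {..<num_children d v})"
  proof (intro equalityI subsetI)
    fix u assume u: "u \<in> tree_level d (Suc m)"
    then obtain i v where "u = i # v" by (cases u) (auto simp: tree_level_def)
    with u show "u \<in> (\<Union>v\<in>tree_level d m. (\<lambda>i. i # v) ` {..<num_children d v})"
    proof (intro UN_I[of v] image_eqI[of _ _ i])
      show "v \<in> tree_level d m" "i \<in> {..<num_children d v}"
        using u \<open>u = i # v\<close> by (simp_all add: tree_level_def tree_vertices_def num_children_def)
    qed (rule \<open>u = i # v\<close>)
  qed (auto simp: tree_level_def tree_vertices_def num_children_def)
  then have "(\<Prod>u\<in>tree_level d (Suc m). h u)
      = (\<Prod>v\<in>tree_level d m. \<Prod>u\<in>(\<lambda>i. i # v) ` {..<num_children d v}. h u)"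
    by (simp, intro prod.UNION_disjoint) auto
  also have "\<dots> = (\<Prod>v\<in>tree_level d m. \<Prod>i<num_children d v. h (i # v))"
    by (intro prod.cong refl) (simp add: prod.reindex inj_on_def)
  finally show ?thesis .
qed

definition tree_ball :: "nat \<Rightarrow> nat \<Rightarrow> nat list set" where
  "tree_ball d m = {v \<in> tree_vertices d. length v \<le> m}"

lemma tree_ball_0: "tree_ball d 0 = {[]}"
  by (auto simp: tree_ball_def tree_vertices_def)

lemma tree_ball_Suc: "tree_ball d (Suc m) = tree_ball d m \<union> tree_level d (Suc m)"
  by (auto simp: tree_ball_def tree_level_def le_Suc_eq)

lemma tree_ball_disjoint: "tree_ball d m \<inter> tree_level d (Suc m) = {}"
  by (auto simp: tree_ball_def tree_level_def)

lemma finite_tree_ball [simp]: "finite (tree_ball d m)"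
  by (induction m) (simp_all add: tree_ball_0 tree_ball_Suc)

lemma tree_level_subset: "tree_level d L \<subseteq> tree_vertices d"
  by (auto simp: tree_level_def)

lemma tree_ball_subset: "tree_ball d m \<subseteq> tree_vertices d"
  by (auto simp: tree_ball_def)

lemma cylinder_sets:
  assumes "finite W" "W \<subseteq> tree_vertices d"
  shows "{\<sigma> \<in> space (tree_chain d a). \<forall>v\<in>W. \<sigma> v = s v} \<in> sets (tree_chain d a)"
proof -
  have "(\<lambda>\<sigma>. \<sigma> v) \<in> tree_chain d a \<rightarrow>\<^sub>M count_space UNIV" if "v \<in> W" for v
    using that assms unfolding measurable_cong_sets[OF sets_tree_chain refl] config_space_def
    by (intro measurable_component_singleton) auto
  from measurable_sets[OF this, of _ "{s _}"]
  have "{\<sigma> \<in> space (tree_chain d a). \<sigma> v = s v} \<in> sets (tree_chain d a)" if "v \<in> W" for v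
    using that by (simp add: vimage_def Int_def conj_commute)
  then show ?thesis using assms(1) by (rule sets.sets_Collect_finite_All)
qed

definition ball_level_event ::
    "nat \<Rightarrow> real \<Rightarrow> nat \<Rightarrow> nat \<Rightarrow> (nat list \<Rightarrow> bool) \<Rightarrow> (nat list \<Rightarrow> bool) \<Rightarrow> (nat list \<Rightarrow> bool) set" where
  "ball_level_event d a m L s t = {\<sigma> \<in> space (tree_chain d a).
     (\<forall>v\<in>tree_ball d m. \<sigma> v = s v) \<and> (\<forall>v\<in>tree_level d L. \<sigma> v = t v)}"

lemma ball_level_event_sets: "ball_level_event d a m L s t \<in> sets (tree_chain d a)"
proof -
  have "ball_level_event d a m L s t = {\<sigma> \<in> space (tree_chain d a). \<forall>v\<in>tree_ball d m. \<sigma> v = s v}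
      \<inter> {\<sigma> \<in> space (tree_chain d a). \<forall>v\<in>tree_level d L. \<sigma> v = t v}"
    by (auto simp: ball_level_event_def)
  then show ?thesis
    by (simp add: sets.Int cylinder_sets tree_ball_subset tree_level_subset)
qed

lemma sum_spin_law:
  assumes a: "0 < a" "a < 1 / 2" "p = a / (1 - a)"
  shows "(\<Sum>c\<in>UNIV. pmf (spin_law a (Some b)) c * f c) = (if b then f False else p * f True + (1 - p) * f False)"
proof -
  have "0 \<le> p" "p \<le> 1" using a by (auto simp: divide_le_eq_1)
  moreover have "(\<Sum>c\<in>UNIV. F c) = F True + F False" for F :: "bool \<Rightarrow> real" by (simp add: UNIV_bool)
  ultimately show ?thesis using a by (cases b) (simp_all only: spin_law.simps, simp_all)
qed

text \<open>Summing out the levels between \<open>m\<close> and \<open>m + j\<close> one at a time, from the bottom, turns the weight of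
  each vertex of level \<open>m\<close> into its likelihood. In the induction step the event is split according to
  the spins on level \<open>m + 1\<close>, and the sum over these spins factors over the vertices.\<close>

lemma measure_ball_level_event:
  assumes a: "0 < a" "a < 1 / 2" "p = a / (1 - a)"
  shows "measure (tree_chain d a) (ball_level_event d a m (m + j) s t)
    = (\<Prod>v\<in>tree_ball d m. pmf (spin_law a (parent_spin s v)) (s v))
      * (\<Prod>v\<in>tree_level d m. lik d p j v (s v) t)"
proof (induction j arbitrary: m s)
  case 0
  have sub: "tree_level d m \<subseteq> tree_ball d m" by (auto simp: tree_level_def tree_ball_def)
  show ?case
  proof (cases "\<forall>v\<in>tree_level d m. t v = s v")
    case True
    then have "ball_level_event d a m (m + 0) s t = {\<sigma> \<in> space (tree_chain d a). \<forall>v\<in>tree_ball d m. \<sigma> v = s v}"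
      using sub by (auto simp: ball_level_event_def)
    moreover have "measure (tree_chain d a) {\<sigma> \<in> space (tree_chain d a). \<forall>v\<in>tree_ball d m. \<sigma> v = s v}
        = (\<Prod>v\<in>tree_ball d m. pmf (spin_law a (parent_spin s v)) (s v))"
    proof (rule tree_chain_cylinder[OF finite_tree_ball tree_ball_subset])
      show "v \<in> tree_ball d m" if "i # v \<in> tree_ball d m" for i v
        using that by (simp add: tree_ball_def tree_vertices_def)
    qed
    ultimately show ?thesis using True by simp
  next
    case False
    then obtain v where v: "v \<in> tree_level d m" "t v \<noteq> s v" by blast
    then have "v \<in> tree_ball d m" using sub by blast
    then have "ball_level_event d a m (m + 0) s t = {}"
      using v unfolding ball_level_event_def by force
    moreover have "(\<Prod>v\<in>tree_level d m. lik d p 0 v (s v) t) = 0"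
      using False by (intro prod_zero) auto
    ultimately show ?thesis by simp
  qed
next
  case (Suc j)
  interpret prob_space "tree_chain d a" by (rule prob_space_tree_chain)
  define ext where "ext r v = (if length v = Suc m then r v else s v)" for r :: "nat list \<Rightarrow> bool" and v :: "nat list"
  let ?E = "\<lambda>r. ball_level_event d a (Suc m) (m + Suc j) (ext r) t"
  let ?R = "configs (tree_level d (Suc m))"
  let ?law = "\<lambda>s v. pmf (spin_law a (parent_spin s v)) (s v)"
  have fin: "finite ?R" by simp
  have ext_ball: "ext r v = s v" if "v \<in> tree_ball d m" for r v
    using that by (auto simp: ext_def tree_ball_def)
  have ext_level: "ext r v = r v" if "v \<in> tree_level d (Suc m)" for r v
    using that by (auto simp: ext_def tree_level_def)
  have union: "ball_level_event d a m (m + Suc j) s t = (\<Union>r\<in>?R. ?E r)"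
  proof (intro equalityI subsetI)
    fix \<sigma> assume \<sigma>: "\<sigma> \<in> ball_level_event d a m (m + Suc j) s t"
    have "\<sigma> \<in> ?E (restrict \<sigma> (tree_level d (Suc m)))"
      using \<sigma> by (auto simp: ball_level_event_def tree_ball_Suc ext_ball ext_level)
    then show "\<sigma> \<in> (\<Union>r\<in>?R. ?E r)" by (intro UN_I) auto
  next
    fix \<sigma> assume "\<sigma> \<in> (\<Union>r\<in>?R. ?E r)"
    then show "\<sigma> \<in> ball_level_event d a m (m + Suc j) s t"
      by (auto simp: ball_level_event_def tree_ball_Suc ext_ball)
  qed
  have disj: "disjoint_family_on ?E ?R"
    unfolding disjoint_family_on_def
  proof (intro ballI impI)
    fix r r' assume r: "r \<in> ?R" "r' \<in> ?R" "r \<noteq> r'"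
    have "\<not> (\<forall>v\<in>tree_level d (Suc m). r v = r' v)"
      using PiE_ext[OF r(1,2)] r(3) by blast
    then obtain v where v: "v \<in> tree_level d (Suc m)" "r v \<noteq> r' v" by blast
    have "\<sigma> v = r v" if "\<sigma> \<in> ?E r" for \<sigma> r
      using that v(1) by (auto simp: ball_level_event_def tree_ball_Suc ext_level)
    then show "?E r \<inter> ?E r' = {}" using v(2) by blast
  qed
  have one: "measure (tree_chain d a) (?E r) = (\<Prod>v\<in>tree_ball d m. ?law s v)
      * (\<Prod>u\<in>tree_level d (Suc m). pmf (spin_law a (Some (s (tl u)))) (r u) * lik d p j u (r u) t)" for r
  proof -
    have "measure (tree_chain d a) (?E r) = (\<Prod>v\<in>tree_ball d (Suc m). ?law (ext r) v)
        * (\<Prod>v\<in>tree_level d (Suc m). lik d p j v (ext r v) t)"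
      using Suc.IH[of "Suc m" "ext r"] by simp
    also have "(\<Prod>v\<in>tree_ball d (Suc m). ?law (ext r) v)
        = (\<Prod>v\<in>tree_ball d m. ?law (ext r) v) * (\<Prod>v\<in>tree_level d (Suc m). ?law (ext r) v)"
      unfolding tree_ball_Suc by (rule prod.union_disjoint) (auto simp: tree_ball_disjoint)
    also have "(\<Prod>v\<in>tree_ball d m. ?law (ext r) v) = (\<Prod>v\<in>tree_ball d m. ?law s v)"
    proof (rule prod.cong[OF refl])
      fix v assume v: "v \<in> tree_ball d m"
      have "parent_spin (ext r) v = parent_spin s v"
        using v by (cases v) (auto simp: parent_spin_def ext_def tree_ball_def)
      then show "?law (ext r) v = ?law s v" using ext_ball[OF v] by simp
    qed
    also have "(\<Prod>v\<in>tree_level d (Suc m). ?law (ext r) v)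
        = (\<Prod>u\<in>tree_level d (Suc m). pmf (spin_law a (Some (s (tl u)))) (r u))"
    proof (rule prod.cong[OF refl])
      fix v assume v: "v \<in> tree_level d (Suc m)"
      have "parent_spin (ext r) v = Some (s (tl v))"
        using v by (cases v) (auto simp: parent_spin_def ext_def tree_level_def)
      then show "?law (ext r) v = pmf (spin_law a (Some (s (tl v)))) (r v)" using ext_level[OF v] by simp
    qed
    also have "(\<Prod>v\<in>tree_level d (Suc m). lik d p j v (ext r v) t) = (\<Prod>v\<in>tree_level d (Suc m). lik d p j v (r v) t)"
      by (rule prod.cong[OF refl]) (simp add: ext_level)
    finally show ?thesis by (simp add: prod.distrib)
  qed
  have "measure (tree_chain d a) (ball_level_event d a m (m + Suc j) s t) = (\<Sum>r\<in>?R. measure (tree_chain d a) (?E r))"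
    unfolding union
    by (rule finite_measure_finite_Union[OF fin _ disj]) (auto simp: ball_level_event_sets)
  also have "\<dots> = (\<Prod>v\<in>tree_ball d m. ?law s v) * (\<Sum>r\<in>?R. \<Prod>u\<in>tree_level d (Suc m).
      pmf (spin_law a (Some (s (tl u)))) (r u) * lik d p j u (r u) t)"
    by (simp only: one sum_distrib_left)
  also have "(\<Sum>r\<in>?R. \<Prod>u\<in>tree_level d (Suc m). pmf (spin_law a (Some (s (tl u)))) (r u) * lik d p j u (r u) t)
      = (\<Prod>u\<in>tree_level d (Suc m). \<Sum>c\<in>UNIV. pmf (spin_law a (Some (s (tl u)))) c * lik d p j u c t)"
    by (rule prod_sum_PiE[symmetric]) auto
  also have "\<dots> = (\<Prod>v\<in>tree_level d m. lik d p (Suc j) v (s v) t)"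
    by (simp only: prod_tree_level_Suc sum_spin_law[OF a] lik.simps list.sel)
  finally show ?case .
qed

lemma measure_root_level:
  assumes a: "0 < a" "a < 1 / 2" "p = a / (1 - a)"
  shows "measure (tree_chain d a) {\<sigma> \<in> space (tree_chain d a). \<sigma> [] = b \<and> (\<forall>v\<in>tree_level d L. \<sigma> v = t v)}
    = (if b then a else 1 - a) * lik d p L [] b t"
proof -
  have lev: "tree_level d 0 = {[]}" by (simp add: tree_level_eq)
  show ?thesis
    using measure_ball_level_event[OF a, of d 0 L "\<lambda>_. b" t] a
    by (simp add: ball_level_event_def tree_ball_0 lev parent_spin_def)
qed

section \<open>Reconstruction as a testing problem\<close>

definition level_event :: "nat \<Rightarrow> real \<Rightarrow> nat \<Rightarrow> (nat list \<Rightarrow> bool) set \<Rightarrow> (nat list \<Rightarrow> bool) set" where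
  "level_event d lam L A = {\<sigma> \<in> space (hardcore_measure d lam). restrict \<sigma> (tree_level d L) \<in> A}"

text \<open>There are finitely many configurations on a level, so every set of configurations is an event.\<close>

lemma sets_level_algebra:
  "sets (level_algebra d L) = {level_event d lam L A | A. A \<subseteq> configs (tree_level d L)}"
proof -
  have cs: "config_space (tree_level d L) = count_space (configs (tree_level d L))"
    unfolding config_space_def by (rule count_space_PiM_finite) auto
  have "(\<lambda>\<sigma>. restrict \<sigma> (tree_level d L)) \<in> space (config_space (tree_vertices d)) \<rightarrow> space (config_space (tree_level d L))"
    by (auto simp: cs)
  from sets_vimage_algebra2[OF this] show ?thesis
    by (auto simp: level_algebra_def level_event_def cs hardcore_measure_def space_tree_chain vimage_def Int_def conj_commute)
qed

lemma prob_root_level_event: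
  assumes a: "0 < hc_density d lam" "hc_density d lam < 1 / 2" "p = hc_density d lam / (1 - hc_density d lam)"
    and A: "A \<subseteq> configs (tree_level d L)"
  shows "measure (hardcore_measure d lam) {\<sigma> \<in> level_event d lam L A. \<sigma> [] = b}
    = (if b then hc_density d lam else 1 - hc_density d lam) * (\<Sum>t\<in>A. lik d p L [] b t)"
proof -
  interpret prob_space "hardcore_measure d lam" by (rule prob_space_hardcore_measure)
  let ?M = "hardcore_measure d lam"
  let ?E = "\<lambda>t. {\<sigma> \<in> space ?M. \<sigma> [] = b \<and> (\<forall>v\<in>tree_level d L. \<sigma> v = t v)}"
  have fin: "finite A" using A by (rule finite_subset) simp
  have restr: "restrict \<sigma> (tree_level d L) = t \<longleftrightarrow> (\<forall>v\<in>tree_level d L. \<sigma> v = t v)" if "t \<in> A" for t \<sigma>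
  proof
    assume "\<forall>v\<in>tree_level d L. \<sigma> v = t v"
    moreover have "t \<in> configs (tree_level d L)" using that A by blast
    ultimately show "restrict \<sigma> (tree_level d L) = t" by (intro PiE_ext[of _ "tree_level d L" "\<lambda>_. UNIV"]) auto
  qed auto
  have union: "{\<sigma> \<in> level_event d lam L A. \<sigma> [] = b} = (\<Union>t\<in>A. ?E t)"
  proof -
    have "restrict \<sigma> (tree_level d L) \<in> A \<longleftrightarrow> (\<exists>t\<in>A. \<forall>v\<in>tree_level d L. \<sigma> v = t v)" for \<sigma>
      using restr[of _ \<sigma>] by (metis (no_types))
    then show ?thesis unfolding level_event_def by auto
  qed
  have sets: "?E t \<in> sets ?M" for t
  proof -
    have "?E t = {\<sigma> \<in> space ?M. \<forall>v\<in>{[]}. \<sigma> v = b} \<inter> {\<sigma> \<in> space ?M. \<forall>v\<in>tree_level d L. \<sigma> v = t v}" by auto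
    also have "\<dots> \<in> sets ?M"
      unfolding hardcore_measure_def
      by (intro sets.Int cylinder_sets tree_level_subset) (simp_all, simp add: tree_vertices_def)
    finally show ?thesis .
  qed
  have disj: "disjoint_family_on ?E A"
    unfolding disjoint_family_on_def
  proof (intro ballI impI)
    fix t t' assume t: "t \<in> A" "t' \<in> A" "t \<noteq> t'"
    show "?E t \<inter> ?E t' = {}"
    proof (rule ccontr)
      assume "?E t \<inter> ?E t' \<noteq> {}"
      then obtain \<sigma> where "\<forall>v\<in>tree_level d L. \<sigma> v = t v" "\<forall>v\<in>tree_level d L. \<sigma> v = t' v" by auto
      then show False using restr t by metis
    qed
  qed
  have "measure ?M (\<Union>t\<in>A. ?E t) = (\<Sum>t\<in>A. measure ?M (?E t))"
    by (rule finite_measure_finite_Union[OF fin _ disj]) (use sets in auto)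
  also have "\<dots> = (\<Sum>t\<in>A. (if b then hc_density d lam else 1 - hc_density d lam) * lik d p L [] b t)"
    unfolding hardcore_measure_def by (rule sum.cong[OF refl], rule measure_root_level[OF a])
  finally show ?thesis unfolding union by (simp only: sum_distrib_left)
qed

text \<open>The defining property of the conditional expectation, evaluated with Bayes' rule: if the two
  likelihood sums are \<open>P\<close> and \<open>Q\<close>, the event has probability \<open>\<alpha> * P + (1 - \<alpha>) * Q\<close>, and
  \<open>\<alpha> * P - \<alpha> * (\<alpha> * P + (1 - \<alpha>) * Q) = \<alpha> * (1 - \<alpha>) * (P - Q)\<close>.\<close>

lemma integral_root_occupied_prob:
  assumes a: "0 < hc_density d lam" "hc_density d lam < 1 / 2" "p = hc_density d lam / (1 - hc_density d lam)"
    and A: "A \<subseteq> configs (tree_level d L)"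
  defines "\<alpha> \<equiv> hc_density d lam"
  shows "(LINT \<sigma>:level_event d lam L A|hardcore_measure d lam. root_occupied_prob d lam L \<sigma> - \<alpha>)
    = \<alpha> * (1 - \<alpha>) * ((\<Sum>t\<in>A. lik d p L [] True t) - (\<Sum>t\<in>A. lik d p L [] False t))"
    and "integrable (hardcore_measure d lam) (root_occupied_prob d lam L)"
    and "AE \<sigma> in hardcore_measure d lam. 0 \<le> root_occupied_prob d lam L \<sigma> \<and> root_occupied_prob d lam L \<sigma> \<le> 1"
proof -
  let ?M = "hardcore_measure d lam" and ?A = "level_event d lam L A"
  interpret prob_space ?M by (rule prob_space_hardcore_measure)
  interpret finite_measure_subalgebra ?M "level_algebra d L"
    by unfold_locales (rule subalgebra_level_algebra)
  let ?R = "{\<sigma> \<in> space ?M. \<sigma> []}"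
  have R: "?R \<in> sets ?M"
    using cylinder_sets[of "{[]}" d "hc_density d lam" "\<lambda>_. True"]
    by (simp add: hardcore_measure_def tree_vertices_def)
  have AF: "?A \<in> sets (level_algebra d L)" using A by (auto simp: sets_level_algebra[of _ _ lam])
  then have AM: "?A \<in> sets ?M" using subalg by (auto simp: subalgebra_def)
  have int: "integrable ?M (indicat_real ?R)" using R by (simp add: emeasure_eq_measure)
  show intg: "integrable ?M (root_occupied_prob d lam L)"
    unfolding root_occupied_prob_def by (rule real_cond_exp_int(1)[OF int])
  show "AE \<sigma> in ?M. 0 \<le> root_occupied_prob d lam L \<sigma> \<and> root_occupied_prob d lam L \<sigma> \<le> 1"
    unfolding root_occupied_prob_def AE_conj_iff
    by (intro conjI real_cond_exp_ge_c real_cond_exp_le_c int) auto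
  have "(LINT \<sigma>:?A|?M. root_occupied_prob d lam L \<sigma>) = (LINT \<sigma>:?A|?M. indicat_real ?R \<sigma>)"
    unfolding root_occupied_prob_def by (rule real_cond_exp_intA[OF int AF, symmetric])
  also have "\<dots> = measure ?M (?A \<inter> ?R)"
  proof -
    have "(LINT \<sigma>:?A|?M. indicat_real ?R \<sigma>) = (LINT \<sigma>|?M. indicat_real (?A \<inter> ?R) \<sigma>)"
      by (simp add: set_lebesgue_integral_def indicator_inter_arith)
    then show ?thesis using AM R by simp
  qed
  also have "?A \<inter> ?R = {\<sigma> \<in> ?A. \<sigma> [] = True}" by (auto simp: level_event_def)
  also have "measure ?M \<dots> = \<alpha> * (\<Sum>t\<in>A. lik d p L [] True t)"
    using prob_root_level_event[OF a A, of True] by (simp add: \<alpha>_def)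
  finally have 1: "(LINT \<sigma>:?A|?M. root_occupied_prob d lam L \<sigma>) = \<alpha> * (\<Sum>t\<in>A. lik d p L [] True t)" .
  have "measure ?M ?A = measure ?M ({\<sigma> \<in> ?A. \<sigma> [] = True} \<union> {\<sigma> \<in> ?A. \<sigma> [] = False})"
    by (rule arg_cong[where f = "measure ?M"]) auto
  also have "\<dots> = measure ?M {\<sigma> \<in> ?A. \<sigma> [] = True} + measure ?M {\<sigma> \<in> ?A. \<sigma> [] = False}"
  proof (rule finite_measure_Union)
    have "{\<sigma> \<in> ?A. \<sigma> [] = True} = ?A \<inter> ?R" by (auto simp: level_event_def)
    then show "{\<sigma> \<in> ?A. \<sigma> [] = True} \<in> sets ?M" using AM R by simp
    have "{\<sigma> \<in> ?A. \<sigma> [] = False} = ?A - ?R" by (auto simp: level_event_def)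
    then show "{\<sigma> \<in> ?A. \<sigma> [] = False} \<in> sets ?M" using AM R by simp
  qed auto
  also have "\<dots> = \<alpha> * (\<Sum>t\<in>A. lik d p L [] True t) + (1 - \<alpha>) * (\<Sum>t\<in>A. lik d p L [] False t)"
    using prob_root_level_event[OF a A, of True] prob_root_level_event[OF a A, of False] by (simp add: \<alpha>_def)
  finally have 2: "measure ?M ?A = \<dots>" .
  have "(LINT \<sigma>:?A|?M. root_occupied_prob d lam L \<sigma> - \<alpha>)
      = (LINT \<sigma>:?A|?M. root_occupied_prob d lam L \<sigma>) - (LINT \<sigma>:?A|?M. \<alpha>)"
  proof (rule set_integral_diff(2))
    show "set_integrable ?M ?A (root_occupied_prob d lam L)"
      unfolding set_integrable_def by (rule integrable_mult_indicator[OF AM intg])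
    show "set_integrable ?M ?A (\<lambda>_. \<alpha>)"
      unfolding set_integrable_def by (rule integrable_mult_indicator[OF AM]) simp
  qed
  also have "(LINT \<sigma>:?A|?M. \<alpha>) = \<alpha> * measure ?M ?A"
    using AM by (simp add: set_lebesgue_integral_def)
  finally show "(LINT \<sigma>:?A|?M. root_occupied_prob d lam L \<sigma> - \<alpha>)
    = \<alpha> * (1 - \<alpha>) * ((\<Sum>t\<in>A. lik d p L [] True t) - (\<Sum>t\<in>A. lik d p L [] False t))"
    unfolding 1 2 by (simp add: algebra_simps)
qed

text \<open>The set where the conditional probability exceeds \<open>\<alpha> + \<epsilon>\<close> is itself an event of level \<open>L\<close>, so
  Markov's inequality on this set, and on the one below \<open>\<alpha> - \<epsilon>\<close>, bounds its probability by the
  total variation distance.\<close>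

lemma nonreconstruction_if_total_variation:
  assumes a: "0 < hc_density d lam" "hc_density d lam < 1 / 2" "p = hc_density d lam / (1 - hc_density d lam)"
    and tv: "(\<lambda>L. \<Sum>t\<in>configs (descendants d L []). \<bar>lik d p L [] True t - lik d p L [] False t\<bar>) \<longlonglongrightarrow> 0"
  shows "nonreconstruction d lam"
proof -
  let ?M = "hardcore_measure d lam" and ?\<alpha> = "hc_density d lam" and ?g = "root_occupied_prob d lam"
  interpret prob_space ?M by (rule prob_space_hardcore_measure)
  define T where "T L = (\<Sum>t\<in>configs (tree_level d L). \<bar>lik d p L [] True t - lik d p L [] False t\<bar>)" for L
  have T: "T \<longlonglongrightarrow> 0" using tv by (simp add: T_def[abs_def] tree_level_eq)
  have meas: "?g L \<in> borel_measurable (level_algebra d L)" for L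
    unfolding root_occupied_prob_def by (rule borel_measurable_cond_exp)
  have space: "space (level_algebra d L) = space ?M" for L
    using subalgebra_level_algebra[of d lam L] by (simp add: subalgebra_def)
  have bound: "\<bar>LINT \<sigma>:B|?M. ?g L \<sigma> - ?\<alpha>\<bar> \<le> T L" if B: "B \<in> sets (level_algebra d L)" for B L
  proof -
    obtain A where A: "A \<subseteq> configs (tree_level d L)" "B = level_event d lam L A"
      using B by (auto simp: sets_level_algebra[of d L lam])
    have "\<bar>LINT \<sigma>:B|?M. ?g L \<sigma> - ?\<alpha>\<bar>
        = ?\<alpha> * (1 - ?\<alpha>) * \<bar>\<Sum>t\<in>A. lik d p L [] True t - lik d p L [] False t\<bar>"
      unfolding A(2) integral_root_occupied_prob(1)[OF a A(1)] using a
      by (simp add: abs_mult sum_subtractf)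
    also have "\<dots> \<le> 1 * \<bar>\<Sum>t\<in>A. lik d p L [] True t - lik d p L [] False t\<bar>"
      using a by (intro mult_right_mono mult_le_one) auto
    also have "\<dots> \<le> (\<Sum>t\<in>A. \<bar>lik d p L [] True t - lik d p L [] False t\<bar>)"
      by (simp add: sum_abs)
    also have "\<dots> \<le> T L"
      unfolding T_def using A(1) by (intro sum_mono2) auto
    finally show ?thesis .
  qed
  \<comment> \<open>The sign \<open>c\<close> selects the upper or the lower tail.\<close>
  have markov: "\<epsilon> * measure ?M B \<le> T L"
    if B: "B \<in> sets (level_algebra d L)" and c: "\<bar>c\<bar> = 1" "\<And>\<sigma>. \<sigma> \<in> B \<Longrightarrow> \<epsilon> \<le> c * (?g L \<sigma> - ?\<alpha>)" for B L \<epsilon> c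
  proof -
    have BM: "B \<in> sets ?M" using B subalgebra_level_algebra[of d lam L] by (auto simp: subalgebra_def)
    have "integrable ?M (?g L)" by (rule integral_root_occupied_prob(2)[OF a order_refl])
    then have int: "set_integrable ?M B (\<lambda>\<sigma>. ?g L \<sigma> - ?\<alpha>)"
      unfolding set_integrable_def by (intro integrable_mult_indicator[OF BM] integrable_diff) simp_all
    have "\<epsilon> * measure ?M B = (LINT \<sigma>:B|?M. \<epsilon>)" using BM by (simp add: set_lebesgue_integral_def)
    also have "\<dots> \<le> (LINT \<sigma>:B|?M. c * (?g L \<sigma> - ?\<alpha>))"
    proof (rule set_integral_mono)
      show "set_integrable ?M B (\<lambda>_. \<epsilon>)"
        unfolding set_integrable_def by (rule integrable_mult_indicator[OF BM]) simp
      show "set_integrable ?M B (\<lambda>\<sigma>. c * (?g L \<sigma> - ?\<alpha>))" using int by simp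
    qed (rule c(2))
    also have "\<dots> = c * (LINT \<sigma>:B|?M. ?g L \<sigma> - ?\<alpha>)" by simp
    also have "\<dots> \<le> \<bar>c\<bar> * \<bar>LINT \<sigma>:B|?M. ?g L \<sigma> - ?\<alpha>\<bar>" by (simp add: abs_mult[symmetric])
    also have "\<dots> \<le> T L" using bound[OF B] c(1) by simp
    finally show ?thesis .
  qed
  show ?thesis
    unfolding nonreconstruction_def tendsto_in_probability_def
  proof (intro allI impI)
    fix \<epsilon> :: real assume \<epsilon>: "0 < \<epsilon>"
    have le: "measure ?M {\<sigma> \<in> space ?M. \<epsilon> < \<bar>?g L \<sigma> - ?\<alpha>\<bar>} \<le> 2 * T L / \<epsilon>" for L
    proof -
      let ?B = "\<lambda>c. {\<sigma> \<in> space (level_algebra d L). \<epsilon> < c * (?g L \<sigma> - ?\<alpha>)}"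
      have B: "?B c \<in> sets (level_algebra d L)" for c using meas by measurable
      have BM: "?B c \<in> sets ?M" for c using B subalgebra_level_algebra[of d lam L] by (auto simp: subalgebra_def)
      have "{\<sigma> \<in> space ?M. \<epsilon> < \<bar>?g L \<sigma> - ?\<alpha>\<bar>} = ?B 1 \<union> ?B (- 1)" by (auto simp: space)
      then have "measure ?M {\<sigma> \<in> space ?M. \<epsilon> < \<bar>?g L \<sigma> - ?\<alpha>\<bar>} \<le> measure ?M (?B 1) + measure ?M (?B (- 1))"
        using measure_Un_le[OF BM[of 1] BM[of "- 1"]] by (simp only:)
      moreover have half: "\<epsilon> * measure ?M (?B c) \<le> T L" if "\<bar>c\<bar> = 1" for c
        by (rule markov[OF B that]) simp
      have "\<epsilon> * measure ?M (?B 1) \<le> T L" "\<epsilon> * measure ?M (?B (- 1)) \<le> T L"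
        using half[of 1] half[of "- 1"] by (simp_all only: abs_minus_cancel abs_one)
      then have "\<epsilon> * (measure ?M (?B 1) + measure ?M (?B (- 1))) \<le> 2 * T L"
        unfolding distrib_left by linarith
      then have "measure ?M (?B 1) + measure ?M (?B (- 1)) \<le> 2 * T L / \<epsilon>"
        using \<epsilon> by (simp only: pos_le_divide_eq mult.commute)
      ultimately show ?thesis by linarith
    qed
    have "(\<lambda>L. 2 * T L / \<epsilon>) \<longlonglongrightarrow> 2 * 0 / \<epsilon>" using \<epsilon> by (intro tendsto_intros T) auto
    then have lim: "(\<lambda>L. 2 * T L / \<epsilon>) \<longlonglongrightarrow> 0" by simp
    show "(\<lambda>L. measure ?M {\<sigma> \<in> space ?M. \<epsilon> < \<bar>?g L \<sigma> - ?\<alpha>\<bar>}) \<longlonglongrightarrow> 0"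
      by (rule tendsto_sandwich[OF _ _ tendsto_const lim]) (use le in auto)
  qed
qed

text \<open>The conditional probability is bounded, so convergence in probability would be convergence in mean,
  and the centred integrals over all events would vanish in the limit.\<close>

lemma reconstruction_if_test:
  assumes a: "0 < hc_density d lam" "hc_density d lam < 1 / 2" "p = hc_density d lam / (1 - hc_density d lam)"
    and A: "\<And>L. A L \<subseteq> configs (descendants d L [])" and c: "0 < c"
    and test: "\<And>L. c \<le> (\<Sum>t\<in>A L. lik d p L [] True t) - (\<Sum>t\<in>A L. lik d p L [] False t)"
  shows "reconstruction d lam"
  unfolding reconstruction_def
proof
  let ?M = "hardcore_measure d lam" and ?\<alpha> = "hc_density d lam" and ?g = "root_occupied_prob d lam"
  interpret prob_space ?M by (rule prob_space_hardcore_measure)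
  assume "nonreconstruction d lam"
  \<comment> \<open>The integral over the event of the test is at least \<open>4 * \<epsilon>\<close>, while concentration would bound it by \<open>2 * \<epsilon>\<close>.\<close>
  define \<epsilon> where "\<epsilon> = ?\<alpha> * (1 - ?\<alpha>) * c / 4"
  have \<epsilon>: "0 < \<epsilon>" using a c by (simp add: \<epsilon>_def)
  have "(\<lambda>L. measure ?M {\<sigma> \<in> space ?M. \<epsilon> < \<bar>?g L \<sigma> - ?\<alpha>\<bar>}) \<longlonglongrightarrow> 0"
    using \<open>nonreconstruction d lam\<close> \<epsilon> unfolding nonreconstruction_def tendsto_in_probability_def by blast
  from order_tendstoD(2)[OF this \<epsilon>]
  obtain L where L: "measure ?M {\<sigma> \<in> space ?M. \<epsilon> < \<bar>?g L \<sigma> - ?\<alpha>\<bar>} < \<epsilon>"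
    by (auto simp: eventually_sequentially)
  define B where "B = {\<sigma> \<in> space ?M. \<epsilon> < \<bar>?g L \<sigma> - ?\<alpha>\<bar>}"
  define E where "E = level_event d lam L (A L)"
  have A': "A L \<subseteq> configs (tree_level d L)" using A by (simp add: tree_level_eq)
  note int = integral_root_occupied_prob[OF a A']
  have EM: "E \<in> sets ?M"
    using A' subalgebra_level_algebra[of d lam L]
    by (auto simp: E_def subalgebra_def sets_level_algebra[of d L lam])
  have BM: "B \<in> sets ?M" unfolding B_def using borel_measurable_integrable[OF int(2)] by measurable
  have "4 * \<epsilon> \<le> ?\<alpha> * (1 - ?\<alpha>) * ((\<Sum>t\<in>A L. lik d p L [] True t) - (\<Sum>t\<in>A L. lik d p L [] False t))"
    unfolding \<epsilon>_def using a test[of L] by simp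
  also have "\<dots> = (LINT \<sigma>:E|?M. ?g L \<sigma> - ?\<alpha>)" unfolding E_def by (rule int(1)[symmetric])
  also have "\<dots> \<le> (LINT \<sigma>|?M. \<epsilon> + indicat_real B \<sigma>)"
    unfolding set_lebesgue_integral_def
  proof (rule integral_mono_AE)
    show "integrable ?M (\<lambda>\<sigma>. indicat_real E \<sigma> *\<^sub>R (?g L \<sigma> - ?\<alpha>))"
      by (rule integrable_mult_indicator[OF EM]) (use int(2) in auto)
    show "integrable ?M (\<lambda>\<sigma>. \<epsilon> + indicat_real B \<sigma>)" using BM by (simp add: emeasure_eq_measure)
    show "AE \<sigma> in ?M. indicat_real E \<sigma> *\<^sub>R (?g L \<sigma> - ?\<alpha>) \<le> \<epsilon> + indicat_real B \<sigma>"
      using int(3) AE_space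
    proof eventually_elim
      case (elim \<sigma>)
      then show ?case using \<epsilon> a by (auto simp: B_def split: split_indicator)
    qed
  qed
  also have "\<dots> = \<epsilon> + measure ?M B" using BM by (simp add: emeasure_eq_measure prob_space)
  also have "\<dots> < 2 * \<epsilon>" using L by (simp add: B_def)
  finally show False using \<epsilon> by simp
qed

section \<open>A recursive test that recovers the root\<close>

text \<open>Whether \<open>v\<close> is declared occupied. Rejecting on a single child declared occupied is the
  natural rule, as an occupied vertex has no occupied neighbour.\<close>

primrec guess :: "nat \<Rightarrow> nat \<Rightarrow> nat list \<Rightarrow> (nat list \<Rightarrow> bool) \<Rightarrow> bool" where
  "guess d 0 v t = t v"
| "guess d (Suc n) v t = (\<forall>i<num_children d v. \<not> guess d n (i # v) t)"

definition guess_prob :: "nat \<Rightarrow> real \<Rightarrow> nat \<Rightarrow> nat list \<Rightarrow> bool \<Rightarrow> real" where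
  "guess_prob d p n v b = (\<Sum>t\<in>configs (descendants d n v). lik d p n v b t * of_bool (guess d n v t))"

lemma guess_cong: "(\<And>u. u \<in> descendants d n v \<Longrightarrow> t u = t' u) \<Longrightarrow> guess d n v t = guess d n v t'"
proof (induction n arbitrary: v)
  case (Suc n)
  have "guess d n (i # v) t = guess d n (i # v) t'" if "i < num_children d v" for i
    using that Suc.prems by (intro Suc.IH) auto
  then show ?case by simp
qed simp

lemma sum_lik: "(\<Sum>t\<in>configs (descendants d n v). lik d p n v b t) = 1"
  using lik_sum_True[of d p n v] lik_sum_False[of d p n v] by (cases b) (simp_all add: lik_sum_def)

lemma sum_lik_not_guess:
  "(\<Sum>t\<in>configs (descendants d n v). lik d p n v b t * of_bool (\<not> guess d n v t)) = 1 - guess_prob d p n v b"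
  using sum_lik[of d p n v b]
  by (simp add: guess_prob_def of_bool_not_iff algebra_simps sum_subtractf)

lemma guess_prob_Suc:
  "guess_prob d p (Suc n) v True = (\<Prod>i<num_children d v. 1 - guess_prob d p n (i # v) False)"
  "guess_prob d p (Suc n) v False = (\<Prod>i<num_children d v.
      p * (1 - guess_prob d p n (i # v) True) + (1 - p) * (1 - guess_prob d p n (i # v) False))"
proof -
  have of_bool_guess: "of_bool (guess d (Suc n) v t)
      = (\<Prod>i<num_children d v. of_bool (\<not> guess d n (i # v) t) :: real)" for t
  proof (cases "guess d (Suc n) v t")
    case False
    then have "\<exists>i<num_children d v. of_bool (\<not> guess d n (i # v) t) = (0::real)" by auto
    then show ?thesis using False by (auto intro!: prod_zero[symmetric])
  qed (auto intro!: prod.neutral[symmetric])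
  have cong: "lik d p n (i # v) b t = lik d p n (i # v) b t' \<and> guess d n (i # v) t = guess d n (i # v) t'"
    if "\<And>u. u \<in> descendants d n (i # v) \<Longrightarrow> t u = t' u" for i b t t'
    using lik_cong[of d n "i # v" t t'] guess_cong[of d n "i # v" t t'] that by blast
  have "guess_prob d p (Suc n) v True = (\<Sum>t\<in>configs (descendants d (Suc n) v).
      \<Prod>i<num_children d v. lik d p n (i # v) False t * of_bool (\<not> guess d n (i # v) t))"
    unfolding guess_prob_def of_bool_guess by (simp add: prod.distrib)
  also have "\<dots> = (\<Prod>i<num_children d v. \<Sum>t\<in>configs (descendants d n (i # v)).
      lik d p n (i # v) False t * of_bool (\<not> guess d n (i # v) t))"
  proof (rule sum_children)
    fix i and t t' :: "nat list \<Rightarrow> bool"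
    assume "\<And>u. u \<in> descendants d n (i # v) \<Longrightarrow> t u = t' u"
    from cong[OF this] show "lik d p n (i # v) False t * of_bool (\<not> guess d n (i # v) t)
        = lik d p n (i # v) False t' * of_bool (\<not> guess d n (i # v) t')" by simp
  qed
  finally show "guess_prob d p (Suc n) v True = (\<Prod>i<num_children d v. 1 - guess_prob d p n (i # v) False)"
    by (simp only: sum_lik_not_guess)
  have "guess_prob d p (Suc n) v False = (\<Sum>t\<in>configs (descendants d (Suc n) v).
      \<Prod>i<num_children d v. mix d p n (i # v) t * of_bool (\<not> guess d n (i # v) t))"
    unfolding guess_prob_def of_bool_guess by (simp add: prod.distrib)
  also have "\<dots> = (\<Prod>i<num_children d v. \<Sum>t\<in>configs (descendants d n (i # v)).
      mix d p n (i # v) t * of_bool (\<not> guess d n (i # v) t))"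
  proof (rule sum_children)
    fix i and t t' :: "nat list \<Rightarrow> bool"
    assume "\<And>u. u \<in> descendants d n (i # v) \<Longrightarrow> t u = t' u"
    from cong[OF this] show "mix d p n (i # v) t * of_bool (\<not> guess d n (i # v) t)
        = mix d p n (i # v) t' * of_bool (\<not> guess d n (i # v) t')" by simp
  qed
  also have "\<dots> = (\<Prod>i<num_children d v.
      p * (1 - guess_prob d p n (i # v) True) + (1 - p) * (1 - guess_prob d p n (i # v) False))"
    by (simp only: sum_lik_not_guess[symmetric] distrib_right sum.distrib sum_distrib_left mult.assoc)
  finally show "guess_prob d p (Suc n) v False = (\<Prod>i<num_children d v.
      p * (1 - guess_prob d p n (i # v) True) + (1 - p) * (1 - guess_prob d p n (i # v) False))" .
qed

lemma guess_prob_bounds: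
  assumes "0 \<le> p" "p \<le> 1"
  shows "0 \<le> guess_prob d p n v b" "guess_prob d p n v b \<le> 1"
proof -
  show "0 \<le> guess_prob d p n v b"
    unfolding guess_prob_def by (intro sum_nonneg mult_nonneg_nonneg lik_nonneg assms) auto
  have "guess_prob d p n v b \<le> (\<Sum>t\<in>configs (descendants d n v). lik d p n v b t)"
    unfolding guess_prob_def
    by (intro sum_mono mult_right_le_one_le lik_nonneg assms) auto
  then show "guess_prob d p n v b \<le> 1" by (simp add: sum_lik)
qed

text \<open>The error bounds \<open>\<eta>\<close> (false alarm) and \<open>\<delta>\<close> (miss) reproduce themselves under the recursion
  \<open>guess_prob_Suc\<close>. A miss needs a false alarm at some child, which is the union bound \<open>d * \<eta>\<close>. The
  number of children is bounded by \<open>d\<close> from above and \<open>d - 1\<close> from below, so the invariant holds at the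
  root as well.\<close>

lemma guess_prob_invariant:
  assumes p: "0 \<le> p" "p \<le> 1"
    and eta: "0 \<le> \<eta>" "\<eta> \<le> 1" and miss: "real d * \<eta> \<le> \<delta>"
    and false_alarm: "(1 - p + p * \<delta>) ^ (d - 1) \<le> \<eta>"
  shows "guess_prob d p n v False \<le> \<eta> \<and> 1 - \<delta> \<le> guess_prob d p n v True"
proof (induction n arbitrary: v)
  case 0
  have del: "0 \<le> \<delta>" using miss eta(1) by (meson mult_nonneg_nonneg of_nat_0_le_iff order_trans)
  have "guess_prob d p 0 v b = lik_sum d p 0 v (\<lambda>x y. if b then x * x else y * x)" for b
    unfolding guess_prob_def lik_sum_def by (rule sum.cong) auto
  then show ?case using eta del by (simp add: lik_sum_0)
next
  case (Suc n)
  let ?m = "num_children d v"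
  have del: "0 \<le> \<delta>" using miss eta(1) by (meson mult_nonneg_nonneg of_nat_0_le_iff order_trans)
  have m: "d - 1 \<le> ?m" "?m \<le> d" by (auto simp: num_children_def)
  have "1 - \<delta> \<le> 1 - real ?m * \<eta>"
    using miss m(2) eta(1) by (smt (verit) mult_right_mono of_nat_mono)
  also have "\<dots> \<le> (1 - \<eta>) ^ ?m"
    using Bernoulli_inequality[of "- \<eta>" ?m] eta by simp
  also have "\<dots> = (\<Prod>i<?m. 1 - \<eta>)" by simp
  also have "\<dots> \<le> guess_prob d p (Suc n) v True"
    unfolding guess_prob_Suc using Suc.IH eta by (intro prod_mono) auto
  finally have 1: "1 - \<delta> \<le> guess_prob d p (Suc n) v True" .
  have "guess_prob d p (Suc n) v False \<le> (\<Prod>i<?m. min 1 (1 - p + p * \<delta>))"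
    unfolding guess_prob_Suc
  proof (intro prod_mono conjI)
    fix i
    let ?x = "guess_prob d p n (i # v) True" and ?y = "guess_prob d p n (i # v) False"
    note b = guess_prob_bounds[OF p, of d n "i # v"]
    show "0 \<le> p * (1 - ?x) + (1 - p) * (1 - ?y)" using b p by simp
    have "p * (1 - ?x) \<le> p * \<delta>" using Suc.IH[of "i # v"] p by (intro mult_left_mono) auto
    moreover have "p * (1 - ?x) \<le> p" using b[of True] p by (intro mult_left_le) auto
    moreover have "(1 - p) * (1 - ?y) \<le> 1 - p" using b[of False] p by (intro mult_left_le) auto
    ultimately show "p * (1 - ?x) + (1 - p) * (1 - ?y) \<le> min 1 (1 - p + p * \<delta>)" by linarith
  qed
  also have "\<dots> \<le> min 1 (1 - p + p * \<delta>) ^ (d - 1)"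
    using m(1) p del by (simp, intro power_decreasing) auto
  also have "\<dots> \<le> (1 - p + p * \<delta>) ^ (d - 1)"
    using p del by (intro power_mono) auto
  finally show ?case using 1 false_alarm by simp
qed

section \<open>Moments of the likelihood ratio\<close>

text \<open>The chord of the concave function \<open>ln\<close> between 1 and 2.\<close>

lemma ln_one_plus_ge: "u * ln 2 \<le> ln (1 + u)" if "0 \<le> u" "u \<le> 1" for u :: real
proof -
  have "(1 - u) * ln 1 + u * ln 2 \<le> ln ((1 - u) *\<^sub>R 1 + u *\<^sub>R 2)"
    using that by (intro concave_onD[OF ln_concave]) auto
  then show ?thesis by (simp add: algebra_simps)
qed

text \<open>The right-hand side is at least \<open>1 / (1 + z + z\<^sup>2 / 2)\<close>, because the product of the two quadratics
  is \<open>1 + z ^ 4 / 4\<close>.\<close>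

lemma exp_minus_le: "exp (- z) \<le> 1 - z + z\<^sup>2 / 2" if "0 \<le> z" for z :: real
proof -
  have e: "1 + z + z\<^sup>2 / 2 \<le> exp z" using that by (rule exp_lower_Taylor_quadratic)
  have pos: "0 < 1 - z + z\<^sup>2 / 2"
  proof -
    have "1 - z + z\<^sup>2 / 2 = ((1 - z)\<^sup>2 + 1) / 2" by (simp add: power2_eq_square field_simps)
    then show ?thesis by (smt (verit) zero_le_power2 half_gt_zero)
  qed
  have "1 \<le> (1 - z + z\<^sup>2 / 2) * (1 + z + z\<^sup>2 / 2)"
  proof -
    have "(1 - z + z\<^sup>2 / 2) * (1 + z + z\<^sup>2 / 2) = 1 + (z\<^sup>2)\<^sup>2 / 4"
      by (simp add: power2_eq_square field_simps)
    then show ?thesis by simp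
  qed
  also have "\<dots> \<le> (1 - z + z\<^sup>2 / 2) * exp z" using e pos by (intro mult_left_mono) auto
  finally show ?thesis by (simp add: exp_minus field_simps)
qed

lemma exp_minus_one_le: "exp z - 1 \<le> 2 * z" if "0 \<le> z" "z \<le> 1" for z :: real
proof -
  have "z * z \<le> z" using that by (intro mult_left_le) auto
  then show ?thesis using exp_bound[OF that] by (simp add: power2_eq_square)
qed

context
  fixes d :: nat and p :: real
  assumes p: "0 < p" "p < 1"
begin

lemma lik_ge_0: "0 \<le> lik d p n v b t"
  using p by (simp add: lik_nonneg)

lemma lik_sum_mono:
  assumes "\<And>t. g (lik d p n v True t) (lik d p n v False t) \<le> h (lik d p n v True t) (lik d p n v False t)"
  shows "lik_sum d p n v g \<le> lik_sum d p n v h"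
  unfolding lik_sum_def by (intro sum_mono assms)

lemma lik_sum_nonneg:
  assumes "\<And>x y. 0 \<le> x \<Longrightarrow> 0 \<le> y \<Longrightarrow> 0 \<le> g x y"
  shows "0 \<le> lik_sum d p n v g"
  unfolding lik_sum_def by (intro sum_nonneg assms lik_ge_0)

lemma mix_ge: "(1 - p) * lik d p n v False t \<le> mix d p n v t"
  using p lik_ge_0[of n v True t] by simp

lemma lik_True_le_False:
  "(1 - p) ^ num_children d v * lik d p (Suc n) v True t \<le> lik d p (Suc n) v False t"
proof -
  have "(\<Prod>i<num_children d v. (1 - p) * lik d p n (i # v) False t)
      \<le> (\<Prod>i<num_children d v. mix d p n (i # v) t)"
    using p by (intro prod_mono conjI mix_ge mult_nonneg_nonneg lik_ge_0) auto
  then show ?thesis by (simp add: prod.distrib)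
qed

text \<open>Absolute continuity; with it the convention \<open>x / 0 = 0\<close> gives the ratio of the likelihoods a harmless value
  at configurations of probability 0.\<close>

lemma lik_True_eq_0:
  assumes "0 < n" "lik d p n v False t = 0"
  shows "lik d p n v True t = 0"
proof -
  obtain n' where n: "n = Suc n'" using assms(1) gr0_implies_Suc by blast
  have "(1 - p) ^ num_children d v * lik d p n v True t \<le> 0"
    using lik_True_le_False[of v n' t] assms(2) n by (simp del: lik.simps)
  moreover have "0 < (1 - p) ^ num_children d v" using p by simp
  ultimately show ?thesis using lik_ge_0[of n v True t] by (simp add: mult_le_0_iff)
qed

text \<open>Only the configuration without an occupied child is compatible with an occupied vertex.\<close>

lemma lik_depth_one:
  assumes "lik d p (Suc 0) v True t \<noteq> 0"
  shows "lik d p (Suc 0) v True t = 1" "lik d p (Suc 0) v False t = (1 - p) ^ num_children d v"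
proof -
  have "\<not> t (i # v)" if "i < num_children d v" for i
    using assms that by (auto simp: prod_zero_iff)
  then show "lik d p (Suc 0) v True t = 1" "lik d p (Suc 0) v False t = (1 - p) ^ num_children d v"
    by simp_all
qed

lemma lik_sum_depth_one:
  "lik_sum d p (Suc 0) v (\<lambda>x y. if x = 0 then y else 0) = 1 - (1 - p) ^ num_children d v"
proof -
  have "lik_sum d p (Suc 0) v (\<lambda>x y. if x = 0 then y else 0)
      = lik_sum d p (Suc 0) v (\<lambda>x y. y - (1 - p) ^ num_children d v * x)"
    unfolding lik_sum_def
  proof (rule sum.cong[OF refl])
    fix t
    show "(if lik d p (Suc 0) v True t = 0 then lik d p (Suc 0) v False t else 0)
      = lik d p (Suc 0) v False t - (1 - p) ^ num_children d v * lik d p (Suc 0) v True t"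
      using lik_depth_one[of v t] by (cases "lik d p (Suc 0) v True t = 0") (simp_all del: lik.simps)
  qed
  then show ?thesis by (simp add: lik_sum_diff lik_sum_cmult lik_sum_True lik_sum_False)
qed

text \<open>If the child \<open>j\<close> has no occupied child of its own, then it looks occupied: its contribution to the
  likelihood of a vacant parent is at least \<open>p\<close>, against \<open>(1 - p) ^ m\<close> for an occupied parent, where \<open>m\<close>
  is the number of children. Together with the
  factor \<open>1 - p\<close> at the other children this brings the posterior odds of the parent down to 1 or less.\<close>

lemma lik_depth_two_large_odds:
  assumes "(1 - p) * lik d p (Suc (Suc 0)) v False t < p * lik d p (Suc (Suc 0)) v True t"
    and j: "j < num_children d v" and same: "\<And>i. num_children d (i # v) = num_children d v"
  shows "lik d p (Suc 0) (j # v) True t = 0"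
proof (rule ccontr)
  define m where "m = num_children d v"
  define q where "q = (1 - p) ^ m"
  define x y where "x i = lik d p (Suc 0) (i # v) True t" and "y i = lik d p (Suc 0) (i # v) False t" for i
  assume "lik d p (Suc 0) (j # v) True t \<noteq> 0"
  from lik_depth_one[OF this] have xj: "x j = 1" and yj: "y j = q"
    by (simp_all only: x_def y_def q_def m_def same)
  have jm: "j \<in> {..<m}" using j by (simp add: m_def)
  have y0: "0 \<le> y i" for i unfolding y_def by (rule lik_ge_0)
  define P where "P = (\<Prod>i\<in>{..<m} - {j}. y i)"
  have P: "0 \<le> P" unfolding P_def by (intro prod_nonneg y0)
  have q0: "0 < q" using p by (simp add: q_def)
  have X: "lik d p (Suc (Suc 0)) v True t = q * P"
    unfolding lik.simps(2)[of d p "Suc 0"] using prod.remove[OF _ jm, of y]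
    by (simp add: m_def[symmetric] y_def[symmetric] P_def yj del: lik.simps)
  have "lik d p (Suc (Suc 0)) v False t = (\<Prod>i<m. p * x i + (1 - p) * y i)"
    unfolding lik.simps(2)[of d p "Suc 0"] by (simp add: m_def x_def y_def del: lik.simps)
  also have "\<dots> = (p + (1 - p) * q) * (\<Prod>i\<in>{..<m} - {j}. p * x i + (1 - p) * y i)"
    using prod.remove[OF _ jm, of "\<lambda>i. p * x i + (1 - p) * y i"] by (simp add: xj yj)
  also have "\<dots> \<ge> (p + (1 - p) * q) * (\<Prod>i\<in>{..<m} - {j}. (1 - p) * y i)"
  proof (intro mult_left_mono prod_mono conjI)
    fix i show "(1 - p) * y i \<le> p * x i + (1 - p) * y i" unfolding x_def y_def by (rule mix_ge)
  qed (use p q0 y0 in auto)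
  finally have "lik d p (Suc (Suc 0)) v False t \<ge> (p + (1 - p) * q) * ((1 - p) ^ (m - 1) * P)"
    using jm by (simp add: prod.distrib P_def)
  then have "(1 - p) * lik d p (Suc (Suc 0)) v False t
      \<ge> (1 - p) * ((p + (1 - p) * q) * ((1 - p) ^ (m - 1) * P))"
    using p by (intro mult_left_mono) auto
  also have "(1 - p) * ((p + (1 - p) * q) * ((1 - p) ^ (m - 1) * P)) = (p + (1 - p) * q) * (q * P)"
  proof -
    have "q = (1 - p) * (1 - p) ^ (m - 1)"
      using jm unfolding q_def by (cases m) auto
    then show ?thesis by (simp add: mult_ac)
  qed
  also have "\<dots> \<ge> p * (q * P)"
    using p q0 P by (intro mult_right_mono) auto
  finally show False using assms(1) X by simp
qed

text \<open>The left-hand side is the probability, given an occupied vertex, that its posterior odds exceed 1. By the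
  previous lemma every one of the \<open>k\<close> children must then have an occupied child.\<close>

lemma lik_sum_depth_two_large_odds:
  assumes same: "num_children d v = k" "\<And>i. num_children d (i # v) = k"
  shows "lik_sum d p (Suc (Suc 0)) v (\<lambda>x y. if (1 - p) * y < p * x then x else 0) \<le> (1 - (1 - p) ^ k) ^ k"
proof -
  have "lik_sum d p (Suc (Suc 0)) v (\<lambda>x y. if (1 - p) * y < p * x then x else 0)
      \<le> (\<Sum>t\<in>configs (descendants d (Suc (Suc 0)) v). \<Prod>i<num_children d v.
            (\<lambda>x y. if x = 0 then y else 0) (lik d p (Suc 0) (i # v) True t) (lik d p (Suc 0) (i # v) False t))"
    unfolding lik_sum_def
  proof (rule sum_mono)
    fix t
    let ?x = "lik d p (Suc (Suc 0)) v True t" and ?y = "lik d p (Suc (Suc 0)) v False t"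
    let ?r = "\<Prod>i<num_children d v. (\<lambda>x y. if x = 0 then y else 0)
      (lik d p (Suc 0) (i # v) True t) (lik d p (Suc 0) (i # v) False t)"
    have "0 \<le> ?r" by (rule prod_nonneg) (simp add: lik_ge_0 del: lik.simps)
    moreover have "?x = ?r" if "(1 - p) * ?y < p * ?x"
    proof -
      have "lik d p (Suc 0) (i # v) True t = 0" if "i < num_children d v" for i
        using lik_depth_two_large_odds[OF \<open>(1 - p) * ?y < p * ?x\<close> that] same by simp
      then show ?thesis by (simp add: lik.simps(2)[of d p "Suc 0"] del: lik.simps)
    qed
    ultimately show "(if (1 - p) * ?y < p * ?x then ?x else 0) \<le> ?r" by (simp del: lik.simps)
  qed
  also have "\<dots> = (\<Prod>i<num_children d v. lik_sum d p (Suc 0) (i # v) (\<lambda>x y. if x = 0 then y else 0))"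
    by (rule sum_children_lik)
  also have "\<dots> = (1 - (1 - p) ^ k) ^ k" by (simp add: lik_sum_depth_one same)
  finally show ?thesis .
qed

text \<open>The posterior probability that a vertex with a vacant parent is vacant.\<close>

definition vac :: "real \<Rightarrow> real \<Rightarrow> real" where
  "vac x y = (1 - p) * y / (p * x + (1 - p) * y)"

text \<open>With the odds \<open>u = p * x / ((1 - p) * y)\<close> of at most 1, \<open>vac x y = 1 / (1 + u)\<close> is at most
  \<open>2 powr - u\<close>. The bound is linear in \<open>x\<close>, so that it can be summed against the law of
  the configuration below an occupied vertex. The factor \<open>1 - s\<close> absorbs the second-order term, hence the
  constant \<open>ln 2\<close> is reached as \<open>s\<close> tends to 0.\<close>

lemma vac_powr_le:
  assumes xy: "0 \<le> x" "0 < y" "p * x \<le> (1 - p) * y" and s: "0 < s" "s < 1"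
  shows "y * vac x y powr s \<le> y - s * (1 - s) * ln 2 * (p / (1 - p)) * x"
proof -
  define u where "u = p * x / ((1 - p) * y)"
  have u: "0 \<le> u" "u \<le> 1" using xy p by (simp_all add: u_def)
  have vac: "vac x y = 1 / (1 + u)"
    unfolding vac_def u_def using xy p by (simp add: field_simps)
  define z where "z = s * (u * ln 2)"
  have ln2: "0 < ln (2::real)" "ln (2::real) < 1" using ln_2_less_1 by auto
  have z: "0 \<le> z" using s u ln2 by (simp add: z_def)
  have "vac x y powr s = exp (- (s * ln (1 + u)))"
    unfolding vac powr_def using u by (simp add: ln_div)
  also have "\<dots> \<le> exp (- z)"
    unfolding z_def using s ln_one_plus_ge[OF u] by simp
  also have "\<dots> \<le> 1 - z + z\<^sup>2 / 2" by (rule exp_minus_le[OF z])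
  also have "\<dots> \<le> 1 - z * (1 - s)"
  proof -
    have "z \<le> s"
      unfolding z_def using s u ln2 by (intro mult_left_le mult_le_one) auto
    then have "z * z \<le> z * s" using z by (rule mult_left_mono)
    moreover have "0 \<le> z * s" using z s by simp
    ultimately show ?thesis by (simp add: power2_eq_square algebra_simps)
  qed
  finally have "y * vac x y powr s \<le> y * (1 - z * (1 - s))" using xy by (intro mult_left_mono) auto
  also have "\<dots> = y - s * (1 - s) * ln 2 * (p / (1 - p)) * x"
    unfolding z_def u_def using xy p by (simp add: field_simps)
  finally show ?thesis .
qed

lemma vac_bounds:
  assumes "0 \<le> x" "0 \<le> y" shows "0 \<le> vac x y" "vac x y \<le> 1"
proof -
  have "0 \<le> p * x" "0 \<le> (1 - p) * y" using assms p by simp_all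
  then show "0 \<le> vac x y" "vac x y \<le> 1" by (auto simp: vac_def divide_le_eq_1)
qed

lemma lik_sum_depth_two_vac_powr:
  assumes same: "num_children d v = k" "\<And>i. num_children d (i # v) = k" and s: "0 < s" "s < 1"
  shows "lik_sum d p (Suc (Suc 0)) v (\<lambda>x y. y * vac x y powr s)
    \<le> 1 - s * (1 - s) * ln 2 * (p / (1 - p)) * (1 - (1 - (1 - p) ^ k) ^ k)"
proof -
  let ?c = "s * (1 - s) * ln 2 * (p / (1 - p))" and ?h = "\<lambda>x y. if (1 - p) * y < p * x then x else 0"
  have c: "0 \<le> ?c" using s p by simp
  have "lik_sum d p (Suc (Suc 0)) v (\<lambda>x y. y * vac x y powr s)
      \<le> lik_sum d p (Suc (Suc 0)) v (\<lambda>x y. y - ?c * (x - ?h x y))"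
  proof (rule lik_sum_mono)
    fix t
    define x y where "x = lik d p (Suc (Suc 0)) v True t" and "y = lik d p (Suc (Suc 0)) v False t"
    have xy: "0 \<le> x" "0 \<le> y" "y = 0 \<Longrightarrow> x = 0"
      unfolding x_def y_def by (auto simp del: lik.simps intro: lik_ge_0 lik_True_eq_0)
    show "y * vac x y powr s \<le> y - ?c * (x - ?h x y)"
    proof (cases "(1 - p) * y < p * x \<or> y = 0")
      case True
      have "vac x y powr s \<le> 1" using vac_bounds[OF xy(1,2)] s by (intro powr_le1) auto
      then have "y * vac x y powr s \<le> y" using xy by (simp add: mult_left_le)
      then show ?thesis using True xy by auto
    next
      case False
      then have "y * vac x y powr s \<le> y - ?c * x"
        using xy by (intro vac_powr_le s) auto
      then show ?thesis using False by simp
    qed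
  qed
  also have "\<dots> = 1 - ?c * (1 - lik_sum d p (Suc (Suc 0)) v ?h)"
    unfolding lik_sum_diff lik_sum_cmult lik_sum_True lik_sum_False ..
  also have "\<dots> \<le> 1 - ?c * (1 - (1 - (1 - p) ^ k) ^ k)"
    using lik_sum_depth_two_large_odds[OF same] c by (intro diff_left_mono mult_left_mono) auto
  finally show ?thesis .
qed

text \<open>The posterior odds of being occupied for a vertex with a vacant parent.\<close>

definition odds :: "real \<Rightarrow> real \<Rightarrow> real" where
  "odds x y = p * x / ((1 - p) * y)"

lemma vac_eq: "vac x y = (1 - p) * (y / (p * x + (1 - p) * y))"
  by (simp add: vac_def)

text \<open>The odds of a vertex are \<open>p / ((1 - p) * (1 - p) ^ k)\<close>, which is the fugacity, times the product of
  the values \<open>vac\<close> of its children.\<close>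

lemma lik_sum_odds_Suc:
  assumes "num_children d v = k"
  shows "lik_sum d p (Suc n) v (\<lambda>x y. x * odds x y powr s)
    = (p / ((1 - p) * (1 - p) ^ k)) powr s * (\<Prod>i<k. lik_sum d p n (i # v) (\<lambda>x y. y * vac x y powr s))"
proof -
  have "lik d p (Suc n) v True t * odds (lik d p (Suc n) v True t) (lik d p (Suc n) v False t) powr s
    = (p / ((1 - p) * (1 - p) ^ k)) powr s * (\<Prod>i<num_children d v. (\<lambda>x y. y * vac x y powr s)
         (lik d p n (i # v) True t) (lik d p n (i # v) False t))" for t
  proof -
    define x y where "x i = lik d p n (i # v) True t" and "y i = lik d p n (i # v) False t" for i
    have xy: "0 \<le> x i" "0 \<le> y i" for i by (simp_all add: x_def y_def lik_ge_0)
    have "(\<Prod>i<k. vac (x i) (y i)) = (1 - p) ^ k * ((\<Prod>i<k. y i) / (\<Prod>i<k. p * x i + (1 - p) * y i))"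
      by (simp add: vac_eq prod.distrib prod_dividef)
    then have "odds (\<Prod>i<k. y i) (\<Prod>i<k. p * x i + (1 - p) * y i)
        = p / ((1 - p) * (1 - p) ^ k) * (\<Prod>i<k. vac (x i) (y i))"
      unfolding odds_def using p by simp
    moreover have "0 \<le> (\<Prod>i<k. vac (x i) (y i))" by (intro prod_nonneg vac_bounds xy)
    moreover have "0 \<le> p / ((1 - p) * (1 - p) ^ k)" using p by simp
    ultimately have "odds (\<Prod>i<k. y i) (\<Prod>i<k. p * x i + (1 - p) * y i) powr s
        = (p / ((1 - p) * (1 - p) ^ k)) powr s * (\<Prod>i<k. vac (x i) (y i) powr s)"
      by (simp only: powr_mult prod_powr_distrib)
    then show ?thesis using assms by (simp add: x_def y_def prod.distrib)
  qed
  then show ?thesis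
    using sum_children_lik[where g = "\<lambda>x y. y * vac x y powr s" and d = d and n = n and v = v and p = p] assms
    unfolding lik_sum_def[of d p "Suc n"] by (simp add: sum_distrib_left[symmetric] del: lik.simps)
qed

text \<open>If \<open>u\<close> denotes the odds, then \<open>vac = 1 / (1 + u)\<close> and \<open>1 / (1 + u) \<ge> 1 - u powr s\<close>.\<close>

lemma lik_sum_vac_ge:
  assumes "0 < n" "0 < s" "s < 1"
  shows "1 - lik_sum d p n v (\<lambda>x y. x * odds x y powr s) \<le> lik_sum d p n v (\<lambda>x y. x * vac x y)"
proof -
  have "lik_sum d p n v (\<lambda>x y. x - x * odds x y powr s) \<le> lik_sum d p n v (\<lambda>x y. x * vac x y)"
  proof (rule lik_sum_mono)
    fix t
    define x y where "x = lik d p n v True t" and "y = lik d p n v False t"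
    have xy: "0 \<le> x" "0 \<le> y" "y = 0 \<Longrightarrow> x = 0"
      unfolding x_def y_def by (auto simp del: lik.simps intro: lik_ge_0 lik_True_eq_0[OF assms(1)])
    define u where "u = odds x y"
    have u: "0 \<le> u" unfolding u_def odds_def using xy p by simp
    show "x - x * odds x y powr s \<le> x * vac x y"
    proof (cases "y = 0")
      case False
      then have vac: "vac x y = 1 / (1 + u)"
        unfolding vac_def u_def odds_def using xy p by (simp add: field_simps)
      \<comment> \<open>The left-hand side is at most \<open>1 - u\<close> for \<open>u \<le> 1\<close> and at most 0 otherwise.\<close>
      have "1 - u powr s \<le> 1 / (1 + u)"
      proof (cases "u \<le> 1")
        case True
        have "u \<le> u powr s"
          using powr_mono'[of s 1 u] u True assms by (cases "u = 0") auto
        moreover have "1 - u \<le> 1 / (1 + u)" using u by (simp add: field_simps)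
        ultimately show ?thesis by linarith
      next
        case False
        then have "1 \<le> u powr s" using assms by (intro ge_one_powr_ge_zero) auto
        moreover have "0 \<le> 1 / (1 + u)" using u by simp
        ultimately show ?thesis by linarith
      qed
      then have "x * (1 - u powr s) \<le> x * vac x y" unfolding vac using xy by (intro mult_left_mono)
      then show ?thesis by (simp add: u_def algebra_simps)
    qed (use xy in simp)
  qed
  then show ?thesis by (simp add: lik_sum_diff lik_sum_True)
qed

text \<open>The second moment of the likelihood ratio under the law given a vacant vertex, so that for
  \<open>n > 0\<close> its variance is \<open>second_moment n v - 1\<close>.\<close>

abbreviation second_moment :: "nat \<Rightarrow> nat list \<Rightarrow> real" where
  "second_moment n v \<equiv> lik_sum d p n v (\<lambda>x y. x\<^sup>2 / y)"

lemma second_moment_Suc: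
  "second_moment (Suc n) v = (\<Prod>i<num_children d v. lik_sum d p n (i # v) (\<lambda>x y. y\<^sup>2 / (p * x + (1 - p) * y)))"
proof -
  have "(lik d p (Suc n) v True t)\<^sup>2 / lik d p (Suc n) v False t
    = (\<Prod>i<num_children d v. (\<lambda>x y. y\<^sup>2 / (p * x + (1 - p) * y))
       (lik d p n (i # v) True t) (lik d p n (i # v) False t))" for t
    by (simp add: prod_dividef prod_power_distrib)
  then show ?thesis
    using sum_children_lik[where g = "\<lambda>x y. y\<^sup>2 / (p * x + (1 - p) * y)" and d = d and n = n and v = v and p = p]
    unfolding lik_sum_def[of d p "Suc n"] by (simp del: lik.simps)
qed

text \<open>Exact form of the factor in \<open>second_moment_Suc\<close>: recognizing occupied children badly, which
  means a large sum of \<open>x * vac x y\<close>, makes the second moment of the parent small.\<close>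

lemma lik_sum_square_vac:
  "lik_sum d p n v (\<lambda>x y. y\<^sup>2 / (p * x + (1 - p) * y))
    = 1 / (1 - p) * (1 - p / (1 - p) * lik_sum d p n v (\<lambda>x y. x * vac x y))"
proof -
  have "lik_sum d p n v (\<lambda>x y. y\<^sup>2 / (p * x + (1 - p) * y))
      = lik_sum d p n v (\<lambda>x y. 1 / (1 - p) * (y - p / (1 - p) * (x * vac x y)))"
    unfolding lik_sum_def
  proof (rule sum.cong[OF refl])
    fix t
    define x y where "x = lik d p n v True t" and "y = lik d p n v False t"
    have xy: "0 \<le> x" "0 \<le> y" unfolding x_def y_def by (simp_all add: lik_ge_0)
    show "y\<^sup>2 / (p * x + (1 - p) * y) = 1 / (1 - p) * (y - p / (1 - p) * (x * vac x y))"
    proof (cases "p * x + (1 - p) * y = 0")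
      case True
      then have "p * x = 0 \<and> (1 - p) * y = 0"
        using p xy by (intro add_nonneg_eq_0_iff[THEN iffD1]) auto
      then show ?thesis using p by simp
    next
      case False
      then have "vac x y * (p * x + (1 - p) * y) = (1 - p) * y" by (simp add: vac_def)
      show ?thesis unfolding vac_def using False p
        by (simp add: divide_simps power2_eq_square) (simp add: algebra_simps)
    qed
  qed
  then show ?thesis by (simp only: lik_sum_diff lik_sum_cmult lik_sum_False)
qed

text \<open>The second-order expansion of \<open>1 / (1 + p * (R - 1))\<close> around \<open>R = 1\<close>, with \<open>R = x / y\<close>. The
  remainder has the denominator \<open>1 - p + p * R\<close>, which is at least \<open>1 - p\<close>, and the linear term
  sums to 0.\<close>

lemma lik_sum_square_le:
  assumes "0 < n" "second_moment n v \<le> 1 + B"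
  shows "lik_sum d p n v (\<lambda>x y. y\<^sup>2 / (p * x + (1 - p) * y)) \<le> 1 + p\<^sup>2 / (1 - p) * B"
proof -
  have "lik_sum d p n v (\<lambda>x y. y\<^sup>2 / (p * x + (1 - p) * y))
      \<le> lik_sum d p n v (\<lambda>x y. y - p * (x - y) + p\<^sup>2 / (1 - p) * (x\<^sup>2 / y - 2 * x + y))"
  proof (rule lik_sum_mono)
    fix t
    define x y where "x = lik d p n v True t" and "y = lik d p n v False t"
    have xy: "0 \<le> x" "0 \<le> y" "y = 0 \<Longrightarrow> x = 0"
      unfolding x_def y_def by (auto simp del: lik.simps intro: lik_ge_0 lik_True_eq_0[OF assms(1)])
    show "y\<^sup>2 / (p * x + (1 - p) * y) \<le> y - p * (x - y) + p\<^sup>2 / (1 - p) * (x\<^sup>2 / y - 2 * x + y)"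
    proof (cases "y = 0")
      case False
      then have y: "0 < y" using xy by simp
      define w where "w = p * x + (1 - p) * y"
      have w: "(1 - p) * y \<le> w" "0 < (1 - p) * y" using xy p y by (simp_all add: w_def)
      \<comment> \<open>Expansion of \<open>1 / w\<close> around \<open>w = y\<close>, using \<open>w - y = p * (x - y)\<close>.\<close>
      have "y\<^sup>2 / w = y - p * (x - y) + p\<^sup>2 * (x - y)\<^sup>2 / w"
        using w by (simp add: field_simps) (simp add: w_def power2_eq_square algebra_simps)
      also have "p\<^sup>2 * (x - y)\<^sup>2 / w \<le> p\<^sup>2 * (x - y)\<^sup>2 / ((1 - p) * y)"
        using w by (intro divide_left_mono) auto
      also have "\<dots> = p\<^sup>2 / (1 - p) * (x\<^sup>2 / y - 2 * x + y)"
        using y p by (simp add: field_simps power2_eq_square)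
      finally show ?thesis by (simp add: w_def)
    qed (use xy in simp)
  qed
  also have "\<dots> = 1 + p\<^sup>2 / (1 - p) * (second_moment n v - 1)"
    unfolding lik_sum_add lik_sum_diff lik_sum_cmult lik_sum_True lik_sum_False by simp
  also have "\<dots> \<le> 1 + p\<^sup>2 / (1 - p) * B"
    using assms p by (intro add_left_mono mult_left_mono) auto
  finally show ?thesis .
qed

lemma second_moment_step:
  assumes "0 < n" "\<And>i. second_moment n (i # v) \<le> 1 + B"
  shows "second_moment (Suc n) v \<le> exp (real (num_children d v) * (p\<^sup>2 / (1 - p) * B))"
proof -
  have "second_moment (Suc n) v \<le> (\<Prod>i<num_children d v. exp (p\<^sup>2 / (1 - p) * B))"
    unfolding second_moment_Suc
  proof (intro prod_mono conjI)
    fix i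
    show "0 \<le> lik_sum d p n (i # v) (\<lambda>x y. y\<^sup>2 / (p * x + (1 - p) * y))"
      using p by (intro lik_sum_nonneg) auto
    show "lik_sum d p n (i # v) (\<lambda>x y. y\<^sup>2 / (p * x + (1 - p) * y)) \<le> exp (p\<^sup>2 / (1 - p) * B)"
      using lik_sum_square_le[OF assms] exp_ge_add_one_self[of "p\<^sup>2 / (1 - p) * B"] by (rule order_trans)
  qed
  then show ?thesis by (simp only: exp_of_nat_mult prod_constant card_lessThan)
qed

lemma sum_abs_lik_le:
  assumes "0 < n"
  shows "(\<Sum>t\<in>configs (descendants d n v). \<bar>lik d p n v True t - lik d p n v False t\<bar>)
    \<le> sqrt (second_moment n v - 1)"
proof -
  let ?T = "configs (descendants d n v)"
  define x y where "x t = lik d p n v True t" and "y t = lik d p n v False t" for t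
  have xy: "0 \<le> x t" "0 \<le> y t" "y t = 0 \<Longrightarrow> x t = 0" for t
    unfolding x_def y_def by (auto simp del: lik.simps intro: lik_ge_0 lik_True_eq_0[OF assms(1)])
  have "(\<Sum>t\<in>?T. \<bar>x t - y t\<bar>)\<^sup>2 = (\<Sum>t\<in>?T. \<bar>x t - y t\<bar> / sqrt (y t) * sqrt (y t))\<^sup>2"
    using xy by (intro arg_cong[where f = "\<lambda>z. z\<^sup>2"] sum.cong) auto
  also have "\<dots> \<le> (\<Sum>t\<in>?T. (\<bar>x t - y t\<bar> / sqrt (y t))\<^sup>2) * (\<Sum>t\<in>?T. (sqrt (y t))\<^sup>2)"
    by (rule Cauchy_Schwarz_ineq_sum)
  also have "(\<Sum>t\<in>?T. (sqrt (y t))\<^sup>2) = 1"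
    using xy lik_sum_False[of d p n v] by (simp add: lik_sum_def y_def)
  also have "(\<Sum>t\<in>?T. (\<bar>x t - y t\<bar> / sqrt (y t))\<^sup>2) = (\<Sum>t\<in>?T. (x t)\<^sup>2 / y t - 2 * x t + y t)"
  proof (rule sum.cong[OF refl])
    fix t
    show "(\<bar>x t - y t\<bar> / sqrt (y t))\<^sup>2 = (x t)\<^sup>2 / y t - 2 * x t + y t"
      using xy[of t] by (cases "y t = 0") (auto simp: power_divide field_simps power2_eq_square)
  qed
  also have "\<dots> = second_moment n v - 1"
    using lik_sum_True[of d p n v] lik_sum_False[of d p n v]
    by (simp add: lik_sum_def x_def y_def sum.distrib sum_subtractf flip: sum_distrib_left)
  finally show ?thesis unfolding x_def y_def by (simp add: real_le_rsqrt)
qed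

text \<open>By the assumption \<open>small\<close> the fractional moment of the odds at depth 3 is at most one half; the
  average of \<open>vac\<close> given an occupied vertex is then at least one half, too. Observing the
  spins of the children themselves would give the second moment \<open>1 / (1 - p) ^ k\<close>.\<close>

lemma second_moment_depth_four:
  assumes same: "\<And>i w. num_children d (i # w) = k" and s: "0 < s" "s < 1"
    and small: "(p / ((1 - p) * (1 - p) ^ k)) powr s
      * exp (- (real k * (s * (1 - s) * ln 2 * (p / (1 - p)) * (1 - (1 - (1 - p) ^ k) ^ k)))) \<le> 1 / 2"
  shows "second_moment 4 (i # v) \<le> 1 / (1 - p) ^ k * exp (- (real k * (p / (1 - p)) / 2))"
proof -
  define \<theta> where "\<theta> = s * (1 - s) * ln 2 * (p / (1 - p)) * (1 - (1 - (1 - p) ^ k) ^ k)"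
  have three: "1 / 2 \<le> lik_sum d p 3 (j # w) (\<lambda>x y. x * vac x y)" for j w
  proof -
    have "lik_sum d p 3 (j # w) (\<lambda>x y. x * odds x y powr s)
      = (p / ((1 - p) * (1 - p) ^ k)) powr s
        * (\<Prod>i<k. lik_sum d p (Suc (Suc 0)) (i # j # w) (\<lambda>x y. y * vac x y powr s))"
      unfolding numeral_3_eq_3 by (rule lik_sum_odds_Suc) (rule same)
    also have "\<dots> \<le> (p / ((1 - p) * (1 - p) ^ k)) powr s * (\<Prod>i<k. exp (- \<theta>))"
    proof (intro mult_left_mono prod_mono conjI)
      fix i
      show "0 \<le> lik_sum d p (Suc (Suc 0)) (i # j # w) (\<lambda>x y. y * vac x y powr s)"
        by (intro lik_sum_nonneg) simp
      have "lik_sum d p (Suc (Suc 0)) (i # j # w) (\<lambda>x y. y * vac x y powr s) \<le> 1 - \<theta>"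
        unfolding \<theta>_def by (rule lik_sum_depth_two_vac_powr[OF same same s])
      also have "\<dots> \<le> exp (- \<theta>)" using exp_ge_add_one_self[of "- \<theta>"] by simp
      finally show "lik_sum d p (Suc (Suc 0)) (i # j # w) (\<lambda>x y. y * vac x y powr s) \<le> exp (- \<theta>)" .
    qed simp
    also have "(\<Prod>i<k. exp (- \<theta>)) = exp (- (real k * \<theta>))"
      by (simp add: exp_of_nat_mult[symmetric])
    also have "(p / ((1 - p) * (1 - p) ^ k)) powr s * exp (- (real k * \<theta>)) \<le> 1 / 2"
      using small by (simp only: \<theta>_def)
    finally show ?thesis using lik_sum_vac_ge[of 3 s "j # w"] s by simp
  qed
  have "second_moment 4 (i # v) = (\<Prod>j<k. 1 / (1 - p) * (1 - p / (1 - p) * lik_sum d p 3 (j # i # v) (\<lambda>x y. x * vac x y)))"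
    using second_moment_Suc[of 3 "i # v"] same by (simp add: lik_sum_square_vac)
  also have "\<dots> \<le> (\<Prod>j<k. 1 / (1 - p) * exp (- (p / (1 - p) / 2)))"
  proof (intro prod_mono conjI)
    fix j
    let ?w = "lik_sum d p 3 (j # i # v) (\<lambda>x y. x * vac x y)"
    have "0 \<le> lik_sum d p 3 (j # i # v) (\<lambda>x y. y\<^sup>2 / (p * x + (1 - p) * y))"
      using p by (intro lik_sum_nonneg) auto
    then show "0 \<le> 1 / (1 - p) * (1 - p / (1 - p) * ?w)" by (simp only: lik_sum_square_vac)
    have "p / (1 - p) * (1 / 2) \<le> p / (1 - p) * ?w" using three p by (intro mult_left_mono) auto
    moreover have "1 + - (p / (1 - p) / 2) \<le> exp (- (p / (1 - p) / 2))" by (rule exp_ge_add_one_self)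
    ultimately have "1 - p / (1 - p) * ?w \<le> exp (- (p / (1 - p) / 2))" by linarith
    then show "1 / (1 - p) * (1 - p / (1 - p) * ?w) \<le> 1 / (1 - p) * exp (- (p / (1 - p) / 2))"
      using p by (intro mult_left_mono) auto
  qed
  also have "\<dots> = 1 / (1 - p) ^ k * exp (real k * (- (p / (1 - p) / 2)))"
    by (simp only: prod_constant card_lessThan power_mult_distrib power_one_over exp_of_nat_mult)
  finally show ?thesis by simp
qed

text \<open>Once the bound \<open>B\<close> on the variance is small enough for \<open>exp z - 1 \<le> 2 * z\<close> to apply in
  \<open>second_moment_step\<close>, the assumption \<open>contract\<close> lets it halve with each level. The number of
  children of the root may differ from \<open>k\<close>, which only changes the exponent in the last step by a factor.\<close>

lemma sum_abs_lik_tendsto_0: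
  assumes same: "\<And>i w. num_children d (i # w) = k"
    and four: "\<And>i v. second_moment 4 (i # v) \<le> 1 + B"
    and B: "0 \<le> B" "real k * (p\<^sup>2 / (1 - p)) * B \<le> 1" and contract: "4 * (real k * (p\<^sup>2 / (1 - p))) \<le> 1"
  shows "(\<lambda>n. \<Sum>t\<in>configs (descendants d n []). \<bar>lik d p n [] True t - lik d p n [] False t\<bar>) \<longlonglongrightarrow> 0"
proof -
  define c where "c = p\<^sup>2 / (1 - p)"
  have c: "0 \<le> c" using p by (simp add: c_def)
  have decay: "second_moment (n + 4) (i # v) \<le> 1 + B * (1 / 2) ^ n" for n i v
  proof (induction n arbitrary: i v)
    case 0
    show ?case using four by simp
  next
    case (Suc n)
    define z where "z = real k * (c * (B * (1 / 2) ^ n))"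
    have "second_moment (Suc (n + 4)) (i # v) \<le> exp z"
      unfolding z_def c_def same[of i v, symmetric]
      by (rule second_moment_step) (use Suc.IH in auto)
    moreover have "z \<le> 1"
    proof -
      have "z = real k * c * B * (1 / 2) ^ n" by (simp add: z_def)
      also have "\<dots> \<le> real k * c * B * 1"
        using B c by (intro mult_left_mono power_le_one mult_nonneg_nonneg) auto
      finally show ?thesis using B by (simp add: c_def)
    qed
    moreover have "0 \<le> z" using B c by (simp add: z_def)
    moreover have "2 * z \<le> B * (1 / 2) ^ Suc n"
    proof -
      have "4 * (real k * c) * (B * (1 / 2) ^ Suc n) \<le> 1 * (B * (1 / 2) ^ Suc n)"
        using contract B unfolding c_def by (intro mult_right_mono) auto
      then show ?thesis by (simp add: z_def mult_ac)
    qed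
    ultimately show ?case using exp_minus_one_le[of z] by simp
  qed
  have le: "(\<Sum>t\<in>configs (descendants d (n + 5) []). \<bar>lik d p (n + 5) [] True t - lik d p (n + 5) [] False t\<bar>)
      \<le> sqrt (exp (real (num_children d []) * (c * (B * (1 / 2) ^ n))) - 1)" for n
  proof -
    have "second_moment (Suc (n + 4)) [] \<le> exp (real (num_children d []) * (c * (B * (1 / 2) ^ n)))"
      unfolding c_def by (rule second_moment_step) (use decay in auto)
    then have "sqrt (second_moment (n + 5) [] - 1)
        \<le> sqrt (exp (real (num_children d []) * (c * (B * (1 / 2) ^ n))) - 1)"
      by (simp add: add.commute)
    moreover have "0 < n + 5" by simp
    ultimately show ?thesis using sum_abs_lik_le[of "n + 5" "[]"] by (meson order_trans)
  qed
  have lim: "(\<lambda>n. sqrt (exp (real (num_children d []) * (c * (B * (1 / 2) ^ n))) - 1)) \<longlonglongrightarrow> 0"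
  proof -
    have "(\<lambda>n. sqrt (exp (real (num_children d []) * (c * (B * (1 / 2) ^ n))) - 1))
        \<longlonglongrightarrow> sqrt (exp (real (num_children d []) * (c * (B * 0))) - 1)"
      by (intro tendsto_intros LIMSEQ_realpow_zero) auto
    then show ?thesis by simp
  qed
  have "(\<lambda>n. \<Sum>t\<in>configs (descendants d (n + 5) []).
      \<bar>lik d p (n + 5) [] True t - lik d p (n + 5) [] False t\<bar>) \<longlonglongrightarrow> 0"
    by (rule tendsto_sandwich[OF _ _ tendsto_const lim])
       (use le in \<open>auto intro!: always_eventually sum_nonneg\<close>)
  then show ?thesis by (rule LIMSEQ_offset)
qed

end

section \<open>Asymptotics of the critical fugacity\<close>

lemma child_occupation:
  assumes lam: "0 < lam" and d: "1 \<le> d"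
  obtains p where "0 < hc_density d lam" "hc_density d lam < 1 / 2"
    "p = hc_density d lam / (1 - hc_density d lam)" "0 < p" "p < 1" "lam = p / (1 - p) ^ d"
proof
  define a where "a = hc_density d lam"
  have a: "0 < a" "a < 1 / 2" and eq: "lam = a / (1 - 2 * a) * ((1 - a) / (1 - 2 * a)) ^ (d - 1)"
    using hc_density_eq[OF lam, of d] by (simp_all only: density_eq_def a_def)
  define p where "p = a / (1 - a)"
  have p1: "1 - p = (1 - 2 * a) / (1 - a)" using a by (simp add: p_def field_simps)
  have "p / (1 - p) ^ d = p / (1 - p) * (1 / (1 - p)) ^ (d - 1)"
    using d by (cases d) (simp_all add: power_one_over)
  also have "p / (1 - p) = a / (1 - 2 * a)" unfolding p1 using a by (simp add: p_def)
  also have "1 / (1 - p) = (1 - a) / (1 - 2 * a)" unfolding p1 by simp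
  finally have "lam = p / (1 - p) ^ d" using eq by simp
  then show "lam = (a / (1 - a)) / (1 - a / (1 - a)) ^ d" by (simp add: p_def)
  show "0 < hc_density d lam" "hc_density d lam < 1 / 2" using a by (simp_all add: a_def)
  show "a / (1 - a) = hc_density d lam / (1 - hc_density d lam)" by (simp add: a_def)
  show "0 < a / (1 - a)" "a / (1 - a) < 1" using a by simp_all
qed

lemma power_one_minus_le_exp:
  fixes p :: real assumes "0 \<le> p" "p \<le> 1" shows "(1 - p) ^ n \<le> exp (- (real n * p))"
proof -
  have "(1 - p) ^ n \<le> exp (- p) ^ n"
    using assms exp_ge_add_one_self[of "- p"] by (intro power_mono) auto
  then show ?thesis by (simp add: exp_of_nat_mult[symmetric])
qed

lemma power_one_minus_ge_exp:
  fixes p :: real assumes "0 \<le> p" "p < 1" shows "exp (- (real n * (p / (1 - p)))) \<le> (1 - p) ^ n"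
proof -
  have "1 / (1 - p) = 1 + p / (1 - p)" using assms by (simp add: field_simps)
  also have "\<dots> \<le> exp (p / (1 - p))" by (rule exp_ge_add_one_self)
  finally have "exp (- (p / (1 - p))) \<le> 1 - p" using assms by (simp add: exp_minus field_simps)
  then have "exp (- (p / (1 - p))) ^ n \<le> (1 - p) ^ n" by (intro power_mono) auto
  then show ?thesis by (simp add: exp_of_nat_mult[symmetric])
qed

text \<open>The function \<open>p / (1 - p) ^ d\<close> is at least \<open>p * exp (d * p)\<close>, which is increasing in \<open>p\<close> and
  equals the right-hand side of the assumption at \<open>p = B / d\<close>.\<close>

lemma occupation_le:
  assumes p: "0 < p" "p < 1" and d: "1 \<le> d" and B: "0 \<le> B" "p / (1 - p) ^ d \<le> B / d * exp B"
  shows "p \<le> B / d"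
proof (rule ccontr)
  assume "\<not> p \<le> B / d"
  then have pB: "B / d < p" by simp
  then have "B < real d * p" using d by (simp add: field_simps)
  have "B / d * exp B < p * exp (real d * p)"
    using pB p B d \<open>B < real d * p\<close> by (intro mult_strict_mono) auto
  also have "\<dots> = p / exp (- (real d * p))" by (simp add: exp_minus field_simps)
  also have "\<dots> \<le> p / (1 - p) ^ d"
    using p by (intro divide_left_mono power_one_minus_le_exp mult_pos_pos) auto
  finally show False using B by simp
qed

lemma occupation_ge:
  assumes p: "0 < p" "p < 1" and d: "2 \<le> d" and B: "0 \<le> B" "B / real (d - 1) * exp B < p / (1 - p) ^ d"
  shows "B \<le> real (d - 1) * (p / (1 - p))"
proof (rule ccontr)
  define x where "x = real (d - 1) * (p / (1 - p))"
  assume "\<not> B \<le> real (d - 1) * (p / (1 - p))"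
  then have x: "x < B" by (simp add: x_def)
  have x0: "0 \<le> x" using p by (simp add: x_def)
  have "(1 - p) ^ d = (1 - p) * (1 - p) ^ (d - 1)" using d by (cases d) auto
  then have "p / (1 - p) ^ d = x / real (d - 1) / (1 - p) ^ (d - 1)" using d p by (simp add: x_def)
  also have "\<dots> \<le> x / real (d - 1) / exp (- x)"
    using p x0 power_one_minus_ge_exp[of p "d - 1"]
    by (intro divide_left_mono) (auto simp: x_def)
  also have "\<dots> = x / real (d - 1) * exp x" by (simp add: exp_minus field_simps)
  also have "\<dots> \<le> B / real (d - 1) * exp B"
    using x x0 B by (intro mult_mono divide_right_mono) auto
  finally show False using B by simp
qed

text \<open>Here \<open>x * (1 - exp (- (x / lam)))\<close> is a lower bound for the expected sum, over the children, of the odds that do not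
  exceed 1; it is increasing in \<open>x\<close>, so that a lower bound \<open>y\<close> on \<open>x\<close> is enough.\<close>

lemma one_minus_exp_mono:
  fixes x y lam :: real
  assumes "0 \<le> y" "y \<le> x" "0 < lam" "y / (2 * lam) \<le> \<tau>"
  shows "y\<^sup>2 / lam * (1 - \<tau>) \<le> x * (1 - exp (- (x / lam)))"
proof -
  define z where "z = y / lam"
  have z: "0 \<le> z" "z / 2 \<le> \<tau>" using assms by (simp_all add: z_def)
  have "z * (1 - \<tau>) \<le> z * (1 - z / 2)" using z by (intro mult_left_mono) auto
  also have "\<dots> \<le> 1 - exp (- z)"
    using exp_minus_le[OF z(1)] by (simp add: power2_eq_square algebra_simps)
  also have "\<dots> \<le> 1 - exp (- (x / lam))" using assms by (simp add: z_def divide_right_mono)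
  finally have "y * (z * (1 - \<tau>)) \<le> y * (1 - exp (- (x / lam)))"
    using assms by (intro mult_left_mono) auto
  also have "\<dots> \<le> x * (1 - exp (- (x / lam)))"
    using assms by (intro mult_right_mono) auto
  finally have "y * (z * (1 - \<tau>)) \<le> x * (1 - exp (- (x / lam)))" .
  then show ?thesis by (simp add: z_def power2_eq_square)
qed

text \<open>The same small number \<open>\<tau>\<close> serves as the exponent of the fractional moment and as the relative error in
  \<open>d * p \<approx> ln d\<close>. The assumption \<open>decay\<close> compares \<open>lam powr \<tau>\<close>, which is at most
  \<open>l powr (2 * \<tau>)\<close>, with the exponential decay of the fractional moment; \<open>upper\<close> and \<open>lower\<close> locate \<open>p\<close>;
  \<open>contract\<close> is what the contraction at depth 4 needs when the second moment is about \<open>sqrt (lam / p)\<close>.\<close>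

lemma nonreconstruction_criterion:
  fixes d :: nat and lam l \<tau> :: real
  defines "l \<equiv> ln (real d)"
  assumes d: "2 \<le> d" and \<tau>: "0 < \<tau>" "\<tau> < 1" and l: "1 \<le> l"
    and lam: "1 \<le> lam" "lam \<le> l\<^sup>2"
    and upper: "l\<^sup>2 \<le> 2 * l * d"
    and lower: "(1 - \<tau>) * l / real (d - 1) * real d powr (1 - \<tau>) < 1"
    and tau: "(1 - \<tau>) * l / (2 * lam) \<le> \<tau>"
    and decay: "2 * ln l * \<tau> + ln 2 \<le> \<tau> * (1 - \<tau>) * ln 2 * (((1 - \<tau>) * l)\<^sup>2 / lam * (1 - \<tau>))"
    and contract: "4 * l * sqrt (2 * l ^ 3 / d) \<le> 1" "32 * l\<^sup>2 / d \<le> 1"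
  shows "nonreconstruction d lam"
proof -
  obtain p where a: "0 < hc_density d lam" "hc_density d lam < 1 / 2"
    "p = hc_density d lam / (1 - hc_density d lam)" and p: "0 < p" "p < 1" and eq: "lam = p / (1 - p) ^ d"
    using child_occupation[of lam d] lam d by (metis le_trans one_le_numeral less_le_trans zero_less_one)
  define k where "k = d - 1"
  define q where "q = (1 - p) ^ k"
  define x where "x = real k * (p / (1 - p))"
  have q: "0 < q" "q < 1" using p d by (auto simp: q_def k_def power_Suc_less_one intro!: power_less_one_iff[THEN iffD2])
  have "(1 - p) ^ d = (1 - p) * q" using d by (cases d) (auto simp: q_def k_def)
  then have lam_q: "lam = p / ((1 - p) * q)" using eq by simp
  have dpos: "0 < real d" using d by simp
  have el: "exp l = real d" using dpos by (simp add: l_def)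
  have p_le: "p \<le> 2 * l / d"
  proof (rule occupation_le[OF p])
    have "2 * l / d * exp (2 * l) = 2 * l * d"
      using dpos el by (simp add: exp_double power2_eq_square)
    then show "p / (1 - p) ^ d \<le> 2 * l / d * exp (2 * l)" using lam upper eq by simp
  qed (use d l in auto)
  have p_half: "p \<le> 1 / 2"
  proof -
    have "l \<le> l\<^sup>2" using l by (simp add: power2_eq_square)
    then have "4 * l \<le> d" using contract(2) dpos l by (simp add: field_simps)
    then have "2 * l / d \<le> 1 / 2" using dpos by (simp add: field_simps)
    then show ?thesis using p_le by simp
  qed
  have x_ge: "(1 - \<tau>) * l \<le> x"
    unfolding x_def k_def
  proof (rule occupation_ge[OF p d])
    have "exp ((1 - \<tau>) * l) = real d powr (1 - \<tau>)" using dpos by (simp add: powr_def l_def)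
    then show "(1 - \<tau>) * l / real (d - 1) * exp ((1 - \<tau>) * l) < p / (1 - p) ^ d"
      using lower lam(1) eq by simp
  qed (use \<tau> l in auto)
  have x_le: "x \<le> 4 * l"
  proof -
    have "p / (1 - p) \<le> p / (1 / 2)" using p p_half by (intro divide_left_mono) auto
    then have "x \<le> real d * (2 * p)" unfolding x_def using d p by (intro mult_mono) (auto simp: k_def)
    also have "\<dots> \<le> 4 * l" using p_le dpos by (simp add: field_simps)
    finally show ?thesis .
  qed
  have x0: "0 \<le> x" using p by (simp add: x_def)
  have kq: "real k * q = x / lam" unfolding lam_q x_def using p q by simp

  have small: "(p / ((1 - p) * (1 - p) ^ k)) powr \<tau>
      * exp (- (real k * (\<tau> * (1 - \<tau>) * ln 2 * (p / (1 - p)) * (1 - (1 - (1 - p) ^ k) ^ k)))) \<le> 1 / 2"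
  proof -
    have "(1 - q) ^ k \<le> exp (- (x / lam))"
      using power_one_minus_le_exp[of q k] q kq by simp
    then have "x * (1 - exp (- (x / lam))) \<le> x * (1 - (1 - q) ^ k)"
      using x0 by (intro mult_left_mono) auto
    moreover have "((1 - \<tau>) * l)\<^sup>2 / lam * (1 - \<tau>) \<le> x * (1 - exp (- (x / lam)))"
      using \<tau> l lam x_ge tau by (intro one_minus_exp_mono) auto
    ultimately have "\<tau> * (1 - \<tau>) * ln 2 * (((1 - \<tau>) * l)\<^sup>2 / lam * (1 - \<tau>))
        \<le> \<tau> * (1 - \<tau>) * ln 2 * (x * (1 - (1 - q) ^ k))"
      using \<tau> by (intro mult_left_mono) auto
    then have *: "2 * ln l * \<tau> + ln 2 \<le> \<tau> * (1 - \<tau>) * ln 2 * (x * (1 - (1 - q) ^ k))"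
      using decay by linarith
    have "ln lam \<le> ln (l\<^sup>2)" using lam by (subst ln_le_cancel_iff) auto
    also have "\<dots> = 2 * ln l" using l by (simp add: ln_realpow)
    finally have "\<tau> * ln lam \<le> \<tau> * (2 * ln l)" using \<tau> by (intro mult_left_mono) auto
    then have "\<tau> * ln lam - \<tau> * (1 - \<tau>) * ln 2 * (x * (1 - (1 - q) ^ k)) \<le> - ln 2"
      using * by (simp add: mult_ac)
    then have "exp (\<tau> * ln lam - \<tau> * (1 - \<tau>) * ln 2 * (x * (1 - (1 - q) ^ k))) \<le> exp (- ln 2)"
      by simp
    also have "exp (- ln 2) = (1 / 2 :: real)" by (simp add: exp_minus)
    also have "exp (\<tau> * ln lam - \<tau> * (1 - \<tau>) * ln 2 * (x * (1 - (1 - q) ^ k)))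
        = lam powr \<tau> * exp (- (real k * (\<tau> * (1 - \<tau>) * ln 2 * (p / (1 - p)) * (1 - (1 - q) ^ k))))"
      using lam(1) by (simp add: powr_def exp_diff exp_minus x_def divide_inverse mult_ac)
    finally show ?thesis unfolding lam_q q_def .
  qed
  define B where "B = 1 / (1 - p) ^ k * exp (- (real k * (p / (1 - p)) / 2))"
  have same: "num_children d (i # w) = k" for i w by (simp add: num_children_def k_def)
  have B: "0 \<le> B" using p by (simp add: B_def)
  have B_le: "B \<le> sqrt (lam / p)"
  proof -
    have "exp (- x) \<le> q" unfolding x_def q_def using p by (intro power_one_minus_ge_exp) auto
    then have "sqrt (exp (- x)) \<le> sqrt q" by simp
    moreover have "sqrt (exp (- x)) = exp (- (x / 2))"
      by (rule real_sqrt_unique) (simp_all add: exp_double[symmetric])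
    ultimately have "B \<le> 1 / q * sqrt q"
      unfolding B_def q_def[symmetric] x_def[symmetric] using q by (intro mult_left_mono) auto
    also have "\<dots> = sqrt (1 / q)" using q by (simp add: real_sqrt_divide field_simps)
    also have "1 / q \<le> lam / p"
      unfolding lam_q using p q by (simp add: field_simps)
    finally show ?thesis by simp
  qed
  have kp: "real k * (p\<^sup>2 / (1 - p)) = x * p" by (simp add: x_def power2_eq_square)
  show ?thesis
  proof (rule nonreconstruction_if_total_variation[OF a], rule sum_abs_lik_tendsto_0[OF p same _ B])
    fix i v
    show "lik_sum d p 4 (i # v) (\<lambda>x y. x\<^sup>2 / y) \<le> 1 + B"
      using second_moment_depth_four[OF p same \<tau> small, of i v] by (simp add: B_def)
  next
    have "p * B \<le> p * sqrt (lam / p)" using B_le p by (intro mult_left_mono) auto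
    also have "\<dots> = sqrt (lam * p)"
      using p lam by (simp add: real_sqrt_divide real_sqrt_mult field_simps)
    also have "\<dots> \<le> sqrt (l\<^sup>2 * (2 * l / d))"
      using lam p p_le by (intro real_sqrt_le_mono mult_mono) auto
    also have "l\<^sup>2 * (2 * l / d) = 2 * l ^ 3 / d" by (simp add: power2_eq_square power3_eq_cube)
    finally have "x * (p * B) \<le> 4 * l * sqrt (2 * l ^ 3 / d)"
      using x_le x0 l p B by (intro mult_mono) auto
    then show "real k * (p\<^sup>2 / (1 - p)) * B \<le> 1" using contract(1) unfolding kp by simp
  next
    have "x * p \<le> 4 * l * (2 * l / d)" using x_le p_le x0 l p by (intro mult_mono) auto
    then show "4 * (real k * (p\<^sup>2 / (1 - p))) \<le> 1"
      using contract(2) unfolding kp by (simp add: power2_eq_square)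
  qed
qed

text \<open>For \<open>lam = c * l\<^sup>2 / ln l\<close> the condition \<open>decay\<close> reads
  \<open>2 * \<tau> * ln l + ln 2 \<le> \<tau> * (1 - \<tau>) ^ 4 * (ln 2 / c) * ln l\<close>. It holds for large \<open>l\<close> if \<open>\<tau>\<close> is small,
  precisely because \<open>ln 2 / c > 2\<close>.\<close>

lemma eventually_nonreconstruction:
  fixes c :: real
  assumes c: "0 < c" "c < ln 2 / 2"
  shows "\<forall>\<^sub>F d in sequentially. nonreconstruction d (c * (ln (real d))\<^sup>2 / ln (ln (real d)))"
proof -
  have "((\<lambda>\<tau>. (1 - \<tau>) ^ 4 * ln 2 / c - 2) \<longlongrightarrow> (1 - 0) ^ 4 * ln 2 / c - 2) (at_right 0)"
    using c by (intro tendsto_intros) auto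
  moreover have "0 < (1 - 0) ^ 4 * ln 2 / c - 2" using c by (simp add: field_simps)
  ultimately have "\<forall>\<^sub>F \<tau> in at_right 0. 0 < (1 - \<tau>) ^ 4 * ln 2 / c - 2"
    by (rule order_tendstoD(1))
  moreover have "\<forall>\<^sub>F \<tau>::real in at_right 0. \<tau> \<in> {0<..<1}"
    by (rule eventually_at_right_real) simp
  ultimately have "\<forall>\<^sub>F \<tau>::real in at_right 0. 0 < (1 - \<tau>) ^ 4 * ln 2 / c - 2 \<and> 0 < \<tau> \<and> \<tau> < 1"
    by eventually_elim auto
  then obtain \<tau> where \<tau>: "0 < (1 - \<tau>) ^ 4 * ln 2 / c - 2" "0 < \<tau>" "\<tau> < 1"
    using eventually_happens[of _ "at_right (0::real)"] trivial_limit_at_right_real by blast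
  define K where "K = \<tau> * ((1 - \<tau>) ^ 4 * ln 2 / c - 2)"
  have K: "0 < K" using \<tau> by (simp add: K_def)
  have c1: "c \<le> 1" using c ln_2_less_1 by simp
  have e1: "\<forall>\<^sub>F d::nat in sequentially. 3 \<le> d" by (rule eventually_ge_at_top)
  have e2: "\<forall>\<^sub>F d::nat in sequentially. 1 \<le> ln (real d)" by real_asymp
  have e3: "\<forall>\<^sub>F d::nat in sequentially. 1 \<le> ln (ln (real d))" by real_asymp
  have e4: "\<forall>\<^sub>F d::nat in sequentially. (ln (real d))\<^sup>2 \<le> 2 * ln (real d) * real d" by real_asymp
  have "((\<lambda>d::nat. (1 - \<tau>) * ln (real d) / real (d - 1) * real d powr (1 - \<tau>)) \<longlongrightarrow> 0) sequentially"
  proof -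
    have lim: "((\<lambda>d::nat. 2 * (ln (real d) * real d powr (- \<tau>))) \<longlongrightarrow> 0) sequentially"
      using \<tau> by real_asymp
    show ?thesis
    proof (rule tendsto_sandwich[OF _ _ tendsto_const lim])
      show "\<forall>\<^sub>F d::nat in sequentially. 0 \<le> (1 - \<tau>) * ln (real d) / real (d - 1) * real d powr (1 - \<tau>)"
        using e2 by eventually_elim (use \<tau> in auto)
      show "\<forall>\<^sub>F d::nat in sequentially. (1 - \<tau>) * ln (real d) / real (d - 1) * real d powr (1 - \<tau>)
          \<le> 2 * (ln (real d) * real d powr (- \<tau>))"
        using e1 e2
      proof eventually_elim
        case (elim d)
        have "(1 - \<tau>) * ln (real d) / real (d - 1) \<le> 1 * ln (real d) / (real d / 2)"
          using elim \<tau> by (intro frac_le mult_right_mono) (auto simp: of_nat_diff)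
        then have "(1 - \<tau>) * ln (real d) / real (d - 1) * real d powr (1 - \<tau>)
            \<le> 1 * ln (real d) / (real d / 2) * real d powr (1 - \<tau>)"
          by (intro mult_right_mono) auto
        also have "\<dots> = 2 * (ln (real d) * real d powr (- \<tau>))"
        proof -
          have "real d powr (1 - \<tau>) = real d * real d powr (- \<tau>)"
            using elim by (simp add: powr_diff powr_minus divide_inverse)
          then show ?thesis using elim by simp
        qed
        finally show ?case .
      qed
    qed
  qed
  then have e5: "\<forall>\<^sub>F d::nat in sequentially. (1 - \<tau>) * ln (real d) / real (d - 1) * real d powr (1 - \<tau>) < 1"
    by (rule order_tendstoD(2)) simp
  have "((\<lambda>d::nat. ln (ln (real d)) / ln (real d)) \<longlongrightarrow> 0) sequentially" by real_asymp
  then have e6: "\<forall>\<^sub>F d::nat in sequentially. ln (ln (real d)) / ln (real d) < 2 * c * \<tau>"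
    by (rule order_tendstoD(2)) (use c \<tau> in simp)
  have "filterlim (\<lambda>d::nat. ln (ln (real d))) at_top sequentially" by real_asymp
  then have e7: "\<forall>\<^sub>F d::nat in sequentially. ln 2 / K \<le> ln (ln (real d))"
    unfolding filterlim_at_top by blast
  have e8: "\<forall>\<^sub>F d::nat in sequentially. 4 * ln (real d) * sqrt (2 * ln (real d) ^ 3 / real d) \<le> 1" by real_asymp
  have e9: "\<forall>\<^sub>F d::nat in sequentially. 32 * (ln (real d))\<^sup>2 / real d \<le> 1" by real_asymp
  have "filterlim (\<lambda>d::nat. (ln (real d))\<^sup>2 / ln (ln (real d))) at_top sequentially" by real_asymp
  then have e10: "\<forall>\<^sub>F d::nat in sequentially. 1 / c \<le> (ln (real d))\<^sup>2 / ln (ln (real d))"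
    unfolding filterlim_at_top by blast
  show ?thesis
    using e1 e2 e3 e4 e5 e6 e7 e8 e9 e10
  proof eventually_elim
    case (elim d)
    define l where "l = ln (real d)"
    define lam where "lam = c * l\<^sup>2 / ln l"
    note e = elim[folded l_def]
    have l: "1 \<le> l" "1 \<le> ln l" using e by auto
    show "nonreconstruction d (c * (ln (real d))\<^sup>2 / ln (ln (real d)))"
      unfolding l_def[symmetric] lam_def[symmetric]
    proof (rule nonreconstruction_criterion[of d \<tau>, folded l_def])
      show "1 \<le> lam" using e(10) c l by (simp add: lam_def field_simps)
      have "c * l\<^sup>2 / ln l \<le> 1 * l\<^sup>2 / 1" using c c1 l by (intro frac_le mult_right_mono) auto
      then show "lam \<le> l\<^sup>2" by (simp add: lam_def)
      have "(1 - \<tau>) * l / (2 * lam) = (1 - \<tau>) * (ln l / l / (2 * c))"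
        using l c by (simp add: lam_def power2_eq_square)
      also have "\<dots> \<le> 1 * \<tau>"
        using e(6) l c \<tau> by (intro mult_mono) (auto simp: field_simps)
      finally show "(1 - \<tau>) * l / (2 * lam) \<le> \<tau>" by simp
      have "\<tau> * (1 - \<tau>) * ln 2 * (((1 - \<tau>) * l)\<^sup>2 / lam * (1 - \<tau>)) = \<tau> * ((1 - \<tau>) ^ 4 * ln 2 / c) * ln l"
        using l c by (simp add: lam_def power_mult_distrib) (simp add: power2_eq_square power4_eq_xxxx)
      moreover have "ln 2 \<le> K * ln l" using e(7) K by (simp add: field_simps)
      ultimately show "2 * ln l * \<tau> + ln 2 \<le> \<tau> * (1 - \<tau>) * ln 2 * (((1 - \<tau>) * l)\<^sup>2 / lam * (1 - \<tau>))"
        by (simp add: K_def algebra_simps)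
    qed (use e \<tau> l in auto)
  qed
qed

text \<open>The invariant of \<open>guess_prob_invariant\<close> is used with \<open>\<eta> = 1 / (d * l)\<close> and \<open>\<delta> = 1 / l\<close>. With this
  choice \<open>(1 + p * \<delta> / (1 - p)) ^ (d - 1)\<close> is about \<open>exp 1\<close>, and the false alarm condition becomes
  \<open>e * l\<^sup>2 \<le> lam\<close> up to the factors with \<open>\<tau>\<close>.\<close>

lemma reconstruction_criterion:
  fixes d :: nat and lam \<tau> e' :: real
  defines "l \<equiv> ln (real d)"
  assumes d: "2 \<le> d" and \<tau>: "0 < \<tau>" and l: "2 \<le> l"
    and e': "(1 + \<tau>)\<^sup>2 * exp ((1 + \<tau>)\<^sup>2) \<le> e'" and lam: "lam = e' * l\<^sup>2"
    and upper: "e' * l \<le> real d powr \<tau>"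
    and tau: "(1 + \<tau>) * l / d \<le> \<tau> / (1 + \<tau>)"
  shows "reconstruction d lam"
proof -
  have "0 < (1 + \<tau>)\<^sup>2 * exp ((1 + \<tau>)\<^sup>2)" using \<tau> by simp
  then have e0: "0 < e'" using e' by linarith
  have lam0: "0 < lam" using lam e0 l by simp
  obtain p where a: "0 < hc_density d lam" "hc_density d lam < 1 / 2"
    "p = hc_density d lam / (1 - hc_density d lam)" and p: "0 < p" "p < 1" and eq: "lam = p / (1 - p) ^ d"
    using child_occupation[OF lam0, of d] d by (metis le_trans one_le_numeral)
  define k where "k = d - 1"
  define q where "q = (1 - p) ^ k"
  have q: "0 < q" using p by (simp add: q_def)
  have "(1 - p) ^ d = (1 - p) * q" using d by (cases d) (auto simp: q_def k_def)
  then have "lam = p / ((1 - p) * q)" using eq by simp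
  then have q_eq: "q = p / (1 - p) / lam" using p q by simp
  have dpos: "0 < real d" using d by simp
  have p_le: "p \<le> (1 + \<tau>) * l / d"
  proof (rule occupation_le[OF p])
    have "exp ((1 + \<tau>) * l) = real d powr (1 + \<tau>)" using dpos by (simp add: powr_def l_def)
    also have "\<dots> = real d * real d powr \<tau>" using dpos by (simp add: powr_add)
    finally have "(1 + \<tau>) * l / d * exp ((1 + \<tau>) * l) = (1 + \<tau>) * (l * real d powr \<tau>)"
      using dpos by simp
    moreover have "lam \<le> l * real d powr \<tau>"
      using mult_left_mono[OF upper, of l] l by (simp add: lam power2_eq_square mult_ac)
    moreover have "1 * (l * real d powr \<tau>) \<le> (1 + \<tau>) * (l * real d powr \<tau>)"
      using \<tau> l by (intro mult_right_mono) auto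
    ultimately show "p / (1 - p) ^ d \<le> (1 + \<tau>) * l / d * exp ((1 + \<tau>) * l)" using eq by simp
  qed (use d l \<tau> in auto)
  have odds_le: "p / (1 - p) \<le> (1 + \<tau>)\<^sup>2 * l / d"
  proof -
    have "p \<le> \<tau> / (1 + \<tau>)" using p_le tau by linarith
    then have "p * (1 + \<tau>) \<le> \<tau>" using \<tau> by (simp add: pos_le_divide_eq)
    then have "1 / (1 + \<tau>) \<le> 1 - p" using \<tau> by (simp add: field_simps)
    then have "p / (1 - p) \<le> p / (1 / (1 + \<tau>))" using p \<tau> by (intro divide_left_mono) auto
    also have "\<dots> = p * (1 + \<tau>)" by simp
    also have "\<dots> \<le> (1 + \<tau>) * l / d * (1 + \<tau>)" using p_le \<tau> by (intro mult_right_mono) auto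
    finally show ?thesis by (simp add: power2_eq_square mult_ac)
  qed
  have "(1 - p + p * (1 / l)) ^ k \<le> 1 / (d * l)"
  proof -
    have "1 - p + p * (1 / l) = (1 - p) * (1 + p / (1 - p) / l)"
      using p l by (simp add: field_simps)
    then have "(1 - p + p * (1 / l)) ^ k = q * (1 + p / (1 - p) / l) ^ k"
      by (simp add: q_def power_mult_distrib)
    also have "\<dots> \<le> q * exp (p / (1 - p) / l) ^ k"
      using q p l exp_ge_add_one_self[of "p / (1 - p) / l"]
      by (intro mult_left_mono power_mono) (auto intro!: add_nonneg_nonneg)
    also have "exp (p / (1 - p) / l) ^ k = exp (real k * (p / (1 - p)) / l)"
      by (simp add: exp_of_nat_mult[symmetric])
    also have "\<dots> \<le> exp ((1 + \<tau>)\<^sup>2)"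
    proof -
      have "real k * (p / (1 - p)) \<le> real d * ((1 + \<tau>)\<^sup>2 * l / d)"
        using odds_le p by (intro mult_mono) (auto simp: k_def)
      also have "\<dots> = (1 + \<tau>)\<^sup>2 * l" using dpos by simp
      finally have "real k * (p / (1 - p)) / l \<le> (1 + \<tau>)\<^sup>2" using l by (simp only: pos_divide_le_eq)
      then show ?thesis by (simp only: exp_le_cancel_iff)
    qed
    also have "q * exp ((1 + \<tau>)\<^sup>2) \<le> ((1 + \<tau>)\<^sup>2 * l / d) / lam * exp ((1 + \<tau>)\<^sup>2)"
      unfolding q_eq using odds_le lam0 by (intro mult_right_mono divide_right_mono) auto
    also have "\<dots> = ((1 + \<tau>)\<^sup>2 * exp ((1 + \<tau>)\<^sup>2)) * (1 / (d * l)) / e'"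
      using l by (simp add: lam power2_eq_square)
    also have "\<dots> \<le> e' * (1 / (d * l)) / e'"
      using e' e0 l dpos by (intro divide_right_mono mult_right_mono) auto
    also have "\<dots> = 1 / (d * l)" using e0 by simp
    finally show ?thesis using q by simp
  qed
  note invariant = guess_prob_invariant[OF less_imp_le[OF p(1)] less_imp_le[OF p(2)] _ _ _ this[unfolded k_def]]
  have small: "1 / (real d * l) \<le> 1 / 4"
    using d l mult_mono[of 2 "real d" 2 l] by (simp add: field_simps)
  have inv: "guess_prob d p n v False \<le> 1 / (real d * l) \<and> 1 - 1 / l \<le> guess_prob d p n v True" for n v
    using dpos l small by (intro invariant) (auto simp: field_simps)
  define A where "A n = {t \<in> configs (descendants d n []). guess d n [] t}" for n
  have gp: "(\<Sum>t\<in>A n. lik d p n [] b t) = guess_prob d p n [] b" for n b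
    unfolding A_def guess_prob_def by (rule sum.mono_neutral_cong_left) auto
  show ?thesis
  proof (rule reconstruction_if_test[OF a])
    show "A n \<subseteq> configs (descendants d n [])" for n by (auto simp: A_def)
    show "1 / 4 \<le> (\<Sum>t\<in>A n. lik d p n [] True t) - (\<Sum>t\<in>A n. lik d p n [] False t)" for n
    proof -
      have "1 / l \<le> 1 / 2" using l by (simp add: field_simps)
      then show ?thesis unfolding gp using inv[of n "[]"] small by linarith
    qed
  qed simp
qed

lemma eventually_reconstruction:
  fixes \<delta> :: real
  assumes \<delta>: "0 < \<delta>"
  shows "\<forall>\<^sub>F d in sequentially. reconstruction d ((exp 1 + \<delta>) * (ln (real d))\<^sup>2)"
proof -
  have "((\<lambda>\<tau>::real. (1 + \<tau>)\<^sup>2 * exp ((1 + \<tau>)\<^sup>2)) \<longlongrightarrow> (1 + 0)\<^sup>2 * exp ((1 + 0)\<^sup>2)) (at_right 0)"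
    by (intro tendsto_intros)
  moreover have "(1 + 0)\<^sup>2 * exp ((1 + 0)\<^sup>2) < exp 1 + \<delta>" using \<delta> by simp
  ultimately have "\<forall>\<^sub>F \<tau> in at_right 0. (1 + \<tau>)\<^sup>2 * exp ((1 + \<tau>)\<^sup>2) < exp 1 + \<delta>"
    by (rule order_tendstoD(2))
  moreover have "\<forall>\<^sub>F \<tau>::real in at_right 0. \<tau> \<in> {0<..<1}"
    by (rule eventually_at_right_real) simp
  ultimately have "\<forall>\<^sub>F \<tau>::real in at_right 0. (1 + \<tau>)\<^sup>2 * exp ((1 + \<tau>)\<^sup>2) < exp 1 + \<delta> \<and> 0 < \<tau>"
    by eventually_elim auto
  then obtain \<tau> where \<tau>: "(1 + \<tau>)\<^sup>2 * exp ((1 + \<tau>)\<^sup>2) < exp 1 + \<delta>" "0 < \<tau>"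
    using eventually_happens[of _ "at_right (0::real)"] trivial_limit_at_right_real by blast
  have e1: "\<forall>\<^sub>F d::nat in sequentially. 2 \<le> d" by (rule eventually_ge_at_top)
  have e2: "\<forall>\<^sub>F d::nat in sequentially. 2 \<le> ln (real d)" by real_asymp
  have "((\<lambda>d::nat. ln (real d) / real d powr \<tau>) \<longlongrightarrow> 0) sequentially" using \<tau>(2) by real_asymp
  then have e3: "\<forall>\<^sub>F d::nat in sequentially. ln (real d) / real d powr \<tau> < 1 / (exp 1 + \<delta>)"
    by (rule order_tendstoD(2)) (use \<delta> in \<open>simp add: add_pos_pos\<close>)
  have "((\<lambda>d::nat. ln (real d) / real d) \<longlongrightarrow> 0) sequentially" by real_asymp
  then have e4: "\<forall>\<^sub>F d::nat in sequentially. ln (real d) / real d < \<tau> / (1 + \<tau>) / (1 + \<tau>)"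
    by (rule order_tendstoD(2)) (use \<tau> in simp)
  show ?thesis
    using e1 e2 e3 e4
  proof eventually_elim
    case (elim d)
    have pos: "0 < exp 1 + \<delta>" "0 < real d powr \<tau>" using \<delta> elim by (auto intro: add_pos_pos)
    have "(exp 1 + \<delta>) * ln (real d) \<le> real d powr \<tau>"
      using elim(3) pos by (simp add: pos_divide_less_eq pos_less_divide_eq mult.commute)
    moreover have "(1 + \<tau>) * ln (real d) / real d \<le> \<tau> / (1 + \<tau>)"
      using mult_left_mono[OF less_imp_le[OF elim(4)], of "1 + \<tau>"] \<tau>(2) by simp
    ultimately show ?case
      using elim \<tau> by (intro reconstruction_criterion[OF elim(1) \<tau>(2) elim(2) less_imp_le[OF \<tau>(1)] refl]) auto
  qed
qed

theorem theorem2: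
  fixes lam_R :: "nat \<Rightarrow> real"
  assumes "\<forall>\<^sub>F d in sequentially. is_reconstruction_threshold d (lam_R d)"
  shows "\<exists>\<epsilon>\<^sub>1 \<epsilon>\<^sub>2 :: nat \<Rightarrow> real. \<epsilon>\<^sub>1 \<longlonglongrightarrow> 0 \<and> \<epsilon>\<^sub>2 \<longlonglongrightarrow> 0 \<and>
    (\<forall>\<^sub>F d in sequentially.
       (ln 2 - \<epsilon>\<^sub>1 d) * (ln (real d))\<^sup>2 / (2 * ln (ln (real d))) \<le> lam_R d \<and>
       lam_R d \<le> (exp 1 + \<epsilon>\<^sub>2 d) * (ln (real d))\<^sup>2)"
proof -
  define S where "S d = (ln (real d))\<^sup>2" for d :: nat
  define W where "W d = 2 * ln (ln (real d))" for d :: nat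
  have pos: "\<forall>\<^sub>F d in sequentially. 0 < S d \<and> 0 < W d"
  proof -
    have "\<forall>\<^sub>F d::nat in sequentially. 0 < ln (ln (real d))" by real_asymp
    moreover have "\<forall>\<^sub>F d::nat in sequentially. 0 < ln (real d)" by real_asymp
    ultimately show ?thesis by eventually_elim (simp add: S_def W_def)
  qed
  \<comment> \<open>The smallest nonnegative error terms for which the two bounds hold.\<close>
  define \<epsilon>1 where "\<epsilon>1 d = max 0 (ln 2 - lam_R d * W d / S d)" for d
  define \<epsilon>2 where "\<epsilon>2 d = max 0 (lam_R d / S d - exp 1)" for d
  \<comment> \<open>If the threshold were smaller than the fugacity used here, there would be reconstruction at the latter.\<close>
  have lower: "\<forall>\<^sub>F d in sequentially. \<epsilon>1 d < \<delta>" if \<delta>: "0 < \<delta>" for \<delta>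
  proof -
    \<comment> \<open>The minimum keeps the fugacity positive.\<close>
    define \<eta> where "\<eta> = min (\<delta> / 2) (ln 2 / 2)"
    have \<eta>: "0 < \<eta>" "\<eta> < \<delta>" "\<eta> < ln 2" using \<delta> by (simp_all add: \<eta>_def min_less_iff_disj)
    have "\<forall>\<^sub>F d in sequentially. nonreconstruction d ((ln 2 - \<eta>) / 2 * (ln (real d))\<^sup>2 / ln (ln (real d)))"
      using \<eta> by (intro eventually_nonreconstruction) auto
    then show ?thesis
      using assms pos
    proof eventually_elim
      case (elim d)
      have "(ln 2 - \<eta>) / 2 * (ln (real d))\<^sup>2 / ln (ln (real d)) = (ln 2 - \<eta>) * S d / W d"
        by (simp add: S_def W_def)
      then have "(ln 2 - \<eta>) * S d / W d \<le> lam_R d"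
        using elim by (metis is_reconstruction_threshold_def not_le reconstruction_def)
      then have "ln 2 - lam_R d * W d / S d \<le> \<eta>" using elim by (simp add: field_simps)
      then show ?case using \<eta> \<delta> by (simp add: \<epsilon>1_def)
    qed
  qed
  have upper: "\<forall>\<^sub>F d in sequentially. \<epsilon>2 d < \<delta>" if \<delta>: "0 < \<delta>" for \<delta>
  proof -
    have "\<forall>\<^sub>F d in sequentially. reconstruction d ((exp 1 + \<delta> / 2) * (ln (real d))\<^sup>2)"
      using \<delta> by (intro eventually_reconstruction) simp
    then show ?thesis
      using assms pos
    proof eventually_elim
      case (elim d)
      have "0 < (exp 1 + \<delta> / 2) * S d" using elim \<delta> by (intro mult_pos_pos add_pos_pos) auto
      then have "lam_R d \<le> (exp 1 + \<delta> / 2) * S d"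
        using elim by (metis S_def is_reconstruction_threshold_def not_le reconstruction_def)
      then have "lam_R d / S d \<le> exp 1 + \<delta> / 2" using elim by (simp add: pos_divide_le_eq)
      then show ?case using \<delta> by (simp add: \<epsilon>2_def)
    qed
  qed
  have lim: "f \<longlonglongrightarrow> 0" if "\<And>d. 0 \<le> f d" "\<And>\<delta>. 0 < \<delta> \<Longrightarrow> \<forall>\<^sub>F d in sequentially. f d < \<delta>" for f :: "nat \<Rightarrow> real"
  proof (rule order_tendstoI)
    show "\<forall>\<^sub>F d in sequentially. y < f d" if "y < 0" for y
      using that \<open>\<And>d. 0 \<le> f d\<close> by (intro always_eventually) (auto intro: less_le_trans)
  qed (rule that(2))
  show ?thesis
  proof (intro exI conjI)
    show "\<epsilon>1 \<longlonglongrightarrow> 0" by (rule lim[OF _ lower]) (simp add: \<epsilon>1_def)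
    show "\<epsilon>2 \<longlonglongrightarrow> 0" by (rule lim[OF _ upper]) (simp add: \<epsilon>2_def)
    show "\<forall>\<^sub>F d in sequentially. (ln 2 - \<epsilon>1 d) * (ln (real d))\<^sup>2 / (2 * ln (ln (real d))) \<le> lam_R d \<and>
       lam_R d \<le> (exp 1 + \<epsilon>2 d) * (ln (real d))\<^sup>2"
      using pos
    proof eventually_elim
      case (elim d)
      have "ln 2 - \<epsilon>1 d \<le> lam_R d * W d / S d" "lam_R d / S d \<le> exp 1 + \<epsilon>2 d"
        by (auto simp: \<epsilon>1_def \<epsilon>2_def)
      then have "(ln 2 - \<epsilon>1 d) * S d / W d \<le> lam_R d" "lam_R d \<le> (exp 1 + \<epsilon>2 d) * S d"
        using elim by (auto simp: field_simps)
      then show ?case by (simp add: S_def W_def)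
    qed
  qed
qed

end
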